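(* Suppose that $n,k\ge 2$ with $n$ even. The algorithm DPillarMin (defined in full in the context) takes as input any two (distinct) servers of $\mathrm{DPillar}_{n,k}$, a source and a destination, and outputs a shortest path from the source server to the destination server; moreover, it computes this path with time complexity $O(k)$ (the $\log n$ factor needed to represent each bit value being suppressed).
   Context: **The network.** For $k\ge 2$ and even $n\ge 2$, the nodes (servers) of the digraph $\mathrm{DPillar}_{n,k}$ are the pairs $(c,v_{k-1}v_{k-2}\ldots v_0)$ with $0\le c\le k-1$ and $0\le v_i\le \frac n2-1$ for all $0\le i\le k-1$; $c$ is the column-index, $v_{k-1}\ldots v_0$ the row-index, and $v_i$ the bit in position $i$. Column-indices and bit positions are taken modulo $k$. From $(c,v_{k-1}\ldots v_0)$ there are edges to the following nodes, where $*$ is any value in $\{0,\ldots,\frac n2-1\}$: (c-edge) the node in column $c+1$ with $v_c$ replaced by $*$; (a-edge) the node in column $c-1$ with $v_{c-1}$ replaced by $*$; (b-edge) the node in column $c$ with $v_c$ replaced by $*\neq v_c$; (d-edge) the node in column $c$ with $v_{c-1}$ replaced by $*\ne v_{c-1}$. Each edge corresponds to a server-switch-server link-pair of the physical datacenter network; the length of a path is its number of edges, and a shortest path is one of minimum length. **Move sequences.** A path is described by a word over $\{a,b,c,d\}$ (powers denote repetition), read left to right, giving the types of the edges used. An edge is said to cover the bit position whose value it may change (from column $c$: position $c$ for c- and b-edges, position $c-1$ for a- and d-edges). Given a destination, each edge used sets the bit at the position it covers to the destination's value of that bit. So a word yields a path from source to destination if it leads from the source column to the destination column and covers every position where the two row-indices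 differ. **Normalization.** Because $\mathrm{DPillar}_{n,k}$ is node-symmetric, the source may be taken to be $(0,00\ldots0)$ and the destination $(x,v_{k-1}\ldots v_0)$. (For a general source $(c,u_{k-1}\ldots u_0)$ and destination $(c',w_{k-1}\ldots w_0)$ this means $x=c'-c \bmod k$, and position $i$ below stands for position $c+i$, with $i\in B$ if and only if $u_{c+i}\neq w_{c+i}$.) Let $B=\{i:0\le i\le k-1,\ v_i\ne0\}$. Let $\Delta_0=1$ if $0\in B$ and $\Delta_0=0$ otherwise; let $\Delta_x=1$ if $x\in B$ and $\Delta_x=0$ otherwise. If $x\neq0$, write $B\setminus\{0,x\}=\{i_1,\ldots,i_r\}\cup\{j_1,\ldots,j_s\}$ with $0<j_s<\cdots<j_1<x<i_1<\cdots<i_r<k$ ($r$ or $s$ may be $0$). If $x=0$, write $B\setminus\{0\}=\{i_1,\ldots,i_r\}$ with $0<i_1<\cdots<i_r<k$. If $r\ge2$ put $\delta_l=i_{l+1}-i_l$ for $1\le l\le r-1$ and $\delta=\max_l\delta_l$. If $s\ge2$ put $\epsilon_l=j_l-j_{l+1}$ for $1\le l\le s-1$ and $\epsilon=\max_l\epsilon_l$. **Algorithm DPillarMin.** Compute $B$ and the quantities above. Then compute the minimum $L$ of the lengths of the following candidate paths, remembering a candidate that attains the minimum, and output that path. (Ties are broken according to the implementation.) *If $x\ne0$*, the candidates are: - always: $c^{k+x}$ (length $k+x$) and $a^{2k-x}$ (length $2k-x$); - if $r=0$: $c^xb^{\Delta_x}$ (length $x+\Delta_x$); - if $s=0$: $b^{\Delta_0}a^{k-x}$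 (length $k-x+\Delta_0$); - if $r=1$: $a^{k-i_1-1}dc^{k-i_1-1+x}b^{\Delta_x}$ (length $2k-2i_1+x-1+\Delta_x$) and $c^{i_1}ba^{i_1-x}$ (length $2i_1-x+1$); - if $s=1$: $b^{\Delta_0}a^{k-j_1-1}dc^{x-j_1-1}$ (length $k-2j_1+x-1+\Delta_0$) and $c^{j_1}ba^{k+j_1-x}$ (length $k+2j_1-x+1$); - if $r\ge2$: for an $l$ with $\delta_l=\delta$, $a^{k-i_{l+1}-1}dc^{k-i_{l+1}-1+i_l}ba^{i_l-x}$ (length $2k-2\delta-x$); $a^{k-i_1-1}dc^{k-i_1-1+x}b^{\Delta_x}$ (length $2k-2i_1+x-1+\Delta_x$); and $c^{i_r}ba^{i_r-x}$ (length $2i_r-x+1$); - if $s\ge2$: for an $l$ with $\epsilon_l=\epsilon$, $c^{j_{l+1}}ba^{j_{l+1}+k-j_l-1}dc^{x-j_l-1}$ (length $k-2\epsilon+x$); $b^{\Delta_0}a^{k-j_s-1}dc^{x-j_s-1}$ (length $k-2j_s+x-1+\Delta_0$); and $c^{j_1}ba^{j_1+k-x}$ (length $k+2j_1-x+1$). *If $x=0$*, the candidates are: - if $r=0$: $b$ (length $1$); - if $r=1$ and $i_1=k-1$: $b^{\Delta_0}d$ (length $1+\Delta_0$); - if $r=1$ and $1=i_1\neq k-1$: $cba$ (length $3$); - if $r=1$ and $1\ne i_1\ne k-1$: $b^{\Delta_0}a^{k-i_1-1}dc^{k-i_1-1}$ (length $2k-2i_1-1+\Delta_0$) and $c^{i_1}ba^{i_1}$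 (length $2i_1+1$); - if $r\ge2$: $c^k$ (length $k$); for an $l$ with $\delta_l=\delta$, $a^{k-i_{l+1}-1}dc^{k-i_{l+1}-1+i_l}ba^{i_l}$ (length $2k-2\delta$); $b^{\Delta_0}a^{k-i_1-1}dc^{k-i_1-1}$ (length $2k-2i_1-1+\Delta_0$); and $c^{i_r}ba^{i_r}$ (length $2i_r+1$). *)

theory Defs
  imports
    "Graph_Theory.Arc_Walk"
    "HOL-Library.Monad_Syntax"
begin

section \<open>The digraph\<close>

text \<open>
  A server is a pair of its column-index and its row-index. The row-index
  \<open>v\<^sub>k\<^sub>-\<^sub>1 \<dots> v\<^sub>0\<close> is the list \<open>v\<close> with \<open>v ! i = v\<^sub>i\<close>, so the list starts with
  the bit in position \<open>0\<close>.
\<close>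

type_synonym server = "nat \<times> nat list"

datatype move = A | B | C | D

text \<open>
  An arc records its type, because for \<open>k = 2\<close> a c-edge and an a-edge can join the
  same two servers in parallel.
\<close>

type_synonym link = "server \<times> move \<times> server"

definition servers :: "nat \<Rightarrow> nat \<Rightarrow> server set" where
  "servers n k = {(c, v). c < k \<and> length v = k \<and> (\<forall>i<k. v ! i < n div 2)}"

text \<open>Column \<open>c - 1\<close>, taken modulo \<open>k\<close>.\<close>

definition prev_col :: "nat \<Rightarrow> nat \<Rightarrow> nat" where
  "prev_col k c = (c + k - 1) mod k"

inductive_set links :: "nat \<Rightarrow> nat \<Rightarrow> link set" for n k where
  c_edge: "\<lbrakk>(c, v) \<in> servers n k; y < n div 2\<rbrakk>
    \<Longrightarrow> ((c, v), C, ((c + 1) mod k, v[c := y])) \<in> links n k"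
| a_edge: "\<lbrakk>(c, v) \<in> servers n k; y < n div 2\<rbrakk>
    \<Longrightarrow> ((c, v), A, (prev_col k c, v[prev_col k c := y])) \<in> links n k"
| b_edge: "\<lbrakk>(c, v) \<in> servers n k; y < n div 2; y \<noteq> v ! c\<rbrakk>
    \<Longrightarrow> ((c, v), B, (c, v[c := y])) \<in> links n k"
| d_edge: "\<lbrakk>(c, v) \<in> servers n k; y < n div 2; y \<noteq> v ! prev_col k c\<rbrakk>
    \<Longrightarrow> ((c, v), D, (c, v[prev_col k c := y])) \<in> links n k"

definition DPillar :: "nat \<Rightarrow> nat \<Rightarrow> (server, link) pre_digraph" where
  "DPillar n k =
    \<lparr>verts = servers n k, arcs = links n k, tail = fst, head = snd \<circ> snd\<rparr>"

text \<open>
  A shortest path visits no vertex twice and is minimal even among all walks, so it is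
  shortest whether or not paths are allowed to revisit vertices.
\<close>

definition shortest_path :: "('a, 'b) pre_digraph \<Rightarrow> 'a \<Rightarrow> 'b list \<Rightarrow> 'a \<Rightarrow> bool" where
  "shortest_path G s p t \<longleftrightarrow>
    pre_digraph.apath G s p t \<and> (\<forall>q. pre_digraph.awalk G s q t \<longrightarrow> length p \<le> length q)"


section \<open>Move sequences\<close>

fun covered :: "nat \<Rightarrow> move \<Rightarrow> nat \<Rightarrow> nat" where
  "covered k C c = c"
| "covered k B c = c"
| "covered k A c = prev_col k c"
| "covered k D c = prev_col k c"

fun next_col :: "nat \<Rightarrow> move \<Rightarrow> nat \<Rightarrow> nat" where
  "next_col k C c = (c + 1) mod k"
| "next_col k A c = prev_col k c"
| "next_col k B c = c"
| "next_col k D c = c"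

definition move_to :: "nat \<Rightarrow> nat list \<Rightarrow> move \<Rightarrow> server \<Rightarrow> server" where
  "move_to k w m = (\<lambda>(c, v). (next_col k m c, v[covered k m c := w ! covered k m c]))"

text \<open>
  The arcs used by a word of moves from a given server, for a destination with row-index \<open>w\<close>.
\<close>

fun word_path :: "nat \<Rightarrow> nat list \<Rightarrow> server \<Rightarrow> move list \<Rightarrow> link list" where
  "word_path k w s [] = []"
| "word_path k w s (m # ms) = (s, m, move_to k w m s) # word_path k w (move_to k w m s) ms"


section \<open>Counting steps\<close>

text \<open>
  A computation returns its result together with the number of steps it takes. As in
  \<open>HOL-Library.Time_Commands\<close>, every call of a function takes one step (\<open>tick\<close>), and a
  bounded number of pattern matches, constructor applications, arithmetic operations and
  comparisons on column-indices, lengths and bit values between two calls is not counted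
  separately. Lists are traversed element by element; there is no constant-time access to a
  list by index. Pure list expressions below only occur on lists of bounded length (the
  candidates, and the factors of a single candidate).
\<close>

datatype 'a timed = Timed (result: 'a) (steps: nat)

definition return :: "'a \<Rightarrow> 'a timed" where
  "return a = Timed a 0"

definition tick :: "unit timed" where
  "tick = Timed () 1"

definition bind_timed :: "'a timed \<Rightarrow> ('a \<Rightarrow> 'b timed) \<Rightarrow> 'b timed" where
  "bind_timed m f = Timed (result (f (result m))) (steps m + steps (f (result m)))"

adhoc_overloading Monad_Syntax.bind \<rightleftharpoons> bind_timed


section \<open>DPillarMin\<close>

subsection \<open>List operations\<close>

fun differences :: "nat list \<Rightarrow> nat list \<Rightarrow> bool list timed" where
  "differences (a # u) (b # w) = do {
     tick;
     ds \<leftarrow> differences u w;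
     return ((a \<noteq> b) # ds)
   }"
| "differences _ _ = do { tick; return [] }"

fun split_list :: "nat \<Rightarrow> 'a list \<Rightarrow> ('a list \<times> 'a list) timed" where
  "split_list (Suc m) (a # as) = do {
     tick;
     (xs, ys) \<leftarrow> split_list m as;
     return (a # xs, ys)
   }"
| "split_list _ as = do { tick; return ([], as) }"

fun append_list :: "'a list \<Rightarrow> 'a list \<Rightarrow> 'a list timed" where
  "append_list [] ys = do { tick; return ys }"
| "append_list (x # xs) ys = do {
     tick;
     zs \<leftarrow> append_list xs ys;
     return (x # zs)
   }"

text \<open>The indices, counted from \<open>i\<close>, of the true entries, in increasing order.\<close>

fun positions :: "nat \<Rightarrow> bool list \<Rightarrow> nat list timed" where
  "positions i [] = do { tick; return [] }"
| "positions i (d # ds) = do {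
     tick;
     is \<leftarrow> positions (i + 1) ds;
     return (if d then i # is else is)
   }"

fun select :: "(nat \<Rightarrow> bool) \<Rightarrow> nat list \<Rightarrow> nat list timed" where
  "select P [] = do { tick; return [] }"
| "select P (i # is) = do {
     tick;
     js \<leftarrow> select P is;
     return (if P i then i # js else js)
   }"

fun occurs :: "nat \<Rightarrow> nat list \<Rightarrow> nat timed" where
  "occurs x [] = do { tick; return 0 }"
| "occurs x (i # is) = do { tick; if i = x then return 1 else occurs x is }"

fun last_of :: "nat \<Rightarrow> nat list \<Rightarrow> nat timed" where
  "last_of i [] = do { tick; return i }"
| "last_of i (j # js) = do { tick; last_of j js }"

text \<open>
  A rule for breaking ties: given the value held so far and a new one that is equally good,
  it decides whether the new one replaces it. Rules only compare pairs of numbers or words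
  with at most five factors, and applying one is not counted separately.
\<close>

type_synonym 'a tie_rule = "'a \<Rightarrow> 'a \<Rightarrow> bool"

text \<open>
  A pair of neighbouring entries with maximum difference, among the given pair and the
  neighbours in an increasing list.
\<close>

fun widest_gap :: "(nat \<times> nat) tie_rule \<Rightarrow> nat \<times> nat \<Rightarrow> nat list \<Rightarrow> (nat \<times> nat) timed" where
  "widest_gap tie (p, q) (i # j # js) = do {
     tick;
     widest_gap tie
       (if q - p < j - i \<or> j - i = q - p \<and> tie (p, q) (i, j) then (i, j) else (p, q))
       (j # js)
   }"
| "widest_gap tie g _ = do { tick; return g }"

subsection \<open>Candidate paths\<close>

text \<open>
  A candidate is its length together with its word, the latter as a list of powers.
  The closed formulas for the lengths are arranged such that subtraction on
  \<^typ>\<open>nat\<close> does not truncate.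
\<close>

type_synonym powers = "(move \<times> nat) list"
type_synonym candidate = "nat \<times> powers"

fun best_candidate :: "powers tie_rule \<Rightarrow> candidate \<Rightarrow> candidate list \<Rightarrow> candidate timed" where
  "best_candidate tie cand [] = do { tick; return cand }"
| "best_candidate tie (L, p) ((L', p') # cands) = do {
     tick;
     best_candidate tie (if L' < L \<or> L' = L \<and> tie p p' then (L', p') else (L, p)) cands
   }"

fun prepend_power :: "move \<Rightarrow> nat \<Rightarrow> move list \<Rightarrow> move list timed" where
  "prepend_power m 0 w = do { tick; return w }"
| "prepend_power m (Suc e) w = do { tick; prepend_power m e (m # w) }"

fun spell_out :: "powers \<Rightarrow> move list timed" where
  "spell_out [] = do { tick; return [] }"
| "spell_out ((m, e) # p) = do { tick; w \<leftarrow> spell_out p; prepend_power m e w }"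

text \<open>
  Candidates determined by the positions \<open>i\<^sub>1 < \<dots> < i\<^sub>r\<close> to the right of \<open>x\<close>, for \<open>x \<noteq> 0\<close>.
  The argument \<open>\<Delta>x\<close> is \<open>\<Delta>\<^sub>x\<close>.
\<close>

fun upper_candidates ::
  "(nat \<times> nat) tie_rule \<Rightarrow> nat \<Rightarrow> nat \<Rightarrow> nat \<Rightarrow> nat list \<Rightarrow> candidate list timed" where
  "upper_candidates tie k x \<Delta>x [] = do {
     tick;
     return [(x + \<Delta>x, [(C, x), (B, \<Delta>x)])]
   }"
| "upper_candidates tie k x \<Delta>x [i\<^sub>1] = do {
     tick;
     return
       [(2 * k - 2 * i\<^sub>1 + x - 1 + \<Delta>x, [(A, k - i\<^sub>1 - 1), (D, 1), (C, k - i\<^sub>1 - 1 + x), (B, \<Delta>x)]),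
        (2 * i\<^sub>1 - x + 1, [(C, i\<^sub>1), (B, 1), (A, i\<^sub>1 - x)])]
   }"
| "upper_candidates tie k x \<Delta>x (i\<^sub>1 # i\<^sub>2 # is) = do {
     tick;
     (p, q) \<leftarrow> widest_gap tie (i\<^sub>1, i\<^sub>2) (i\<^sub>2 # is);
     i\<^sub>r \<leftarrow> last_of i\<^sub>2 is;
     return
       [(2 * k - 2 * (q - p) - x, [(A, k - q - 1), (D, 1), (C, k - q - 1 + p), (B, 1), (A, p - x)]),
        (2 * k - 2 * i\<^sub>1 + x - 1 + \<Delta>x, [(A, k - i\<^sub>1 - 1), (D, 1), (C, k - i\<^sub>1 - 1 + x), (B, \<Delta>x)]),
        (2 * i\<^sub>r - x + 1, [(C, i\<^sub>r), (B, 1), (A, i\<^sub>r - x)])]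
   }"

text \<open>
  Candidates determined by the positions \<open>j\<^sub>s < \<dots> < j\<^sub>1\<close> strictly between \<open>0\<close> and \<open>x\<close>,
  for \<open>x \<noteq> 0\<close>. The list is increasing, so it starts with \<open>j\<^sub>s\<close>, and the pair \<open>(p, q)\<close> is
  \<open>(j\<^sub>l\<^sub>+\<^sub>1, j\<^sub>l)\<close>. \<open>j\<^sub>t\<close> stands for \<open>j\<^sub>s\<^sub>-\<^sub>1\<close>.
\<close>

fun lower_candidates ::
  "(nat \<times> nat) tie_rule \<Rightarrow> nat \<Rightarrow> nat \<Rightarrow> nat \<Rightarrow> nat list \<Rightarrow> candidate list timed" where
  "lower_candidates tie k x \<Delta>\<^sub>0 [] = do {
     tick;
     return [(k - x + \<Delta>\<^sub>0, [(B, \<Delta>\<^sub>0), (A, k - x)])]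
   }"
| "lower_candidates tie k x \<Delta>\<^sub>0 [j\<^sub>1] = do {
     tick;
     return
       [(k + x - 2 * j\<^sub>1 - 1 + \<Delta>\<^sub>0, [(B, \<Delta>\<^sub>0), (A, k - j\<^sub>1 - 1), (D, 1), (C, x - j\<^sub>1 - 1)]),
        (k + 2 * j\<^sub>1 - x + 1, [(C, j\<^sub>1), (B, 1), (A, k + j\<^sub>1 - x)])]
   }"
| "lower_candidates tie k x \<Delta>\<^sub>0 (j\<^sub>s # j\<^sub>t # js) = do {
     tick;
     (p, q) \<leftarrow> widest_gap tie (j\<^sub>s, j\<^sub>t) (j\<^sub>t # js);
     j\<^sub>1 \<leftarrow> last_of j\<^sub>t js;
     return
       [(k + x - 2 * (q - p), [(C, p), (B, 1), (A, p + k - q - 1), (D, 1), (C, x - q - 1)]),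
        (k + x - 2 * j\<^sub>s - 1 + \<Delta>\<^sub>0, [(B, \<Delta>\<^sub>0), (A, k - j\<^sub>s - 1), (D, 1), (C, x - j\<^sub>s - 1)]),
        (k + 2 * j\<^sub>1 - x + 1, [(C, j\<^sub>1), (B, 1), (A, j\<^sub>1 + k - x)])]
   }"

text \<open>Candidates for \<open>x = 0\<close>; the list is never empty.\<close>

fun same_column_candidates ::
  "(nat \<times> nat) tie_rule \<Rightarrow> nat \<Rightarrow> nat \<Rightarrow> nat list \<Rightarrow> candidate list timed" where
  "same_column_candidates tie k \<Delta>\<^sub>0 [] = do {
     tick;
     return [(1, [(B, 1)])]
   }"
| "same_column_candidates tie k \<Delta>\<^sub>0 [i\<^sub>1] = do {
     tick;
     return
       (if i\<^sub>1 = k - 1 then [(1 + \<Delta>\<^sub>0, [(B, \<Delta>\<^sub>0), (D, 1)])]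
        else if i\<^sub>1 = 1 then [(3, [(C, 1), (B, 1), (A, 1)])]
        else
          [(2 * k - 2 * i\<^sub>1 - 1 + \<Delta>\<^sub>0, [(B, \<Delta>\<^sub>0), (A, k - i\<^sub>1 - 1), (D, 1), (C, k - i\<^sub>1 - 1)]),
           (2 * i\<^sub>1 + 1, [(C, i\<^sub>1), (B, 1), (A, i\<^sub>1)])])
   }"
| "same_column_candidates tie k \<Delta>\<^sub>0 (i\<^sub>1 # i\<^sub>2 # is) = do {
     tick;
     (p, q) \<leftarrow> widest_gap tie (i\<^sub>1, i\<^sub>2) (i\<^sub>2 # is);
     i\<^sub>r \<leftarrow> last_of i\<^sub>2 is;
     return
       [(k, [(C, k)]),
        (2 * k - 2 * (q - p), [(A, k - q - 1), (D, 1), (C, k - q - 1 + p), (B, 1), (A, p)]),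
        (2 * k - 2 * i\<^sub>1 - 1 + \<Delta>\<^sub>0, [(B, \<Delta>\<^sub>0), (A, k - i\<^sub>1 - 1), (D, 1), (C, k - i\<^sub>1 - 1)]),
        (2 * i\<^sub>r + 1, [(C, i\<^sub>r), (B, 1), (A, i\<^sub>r)])]
   }"

subsection \<open>The algorithm\<close>

text \<open>
  Position \<open>i\<close> of the normalized problem is position \<open>c + i\<close> modulo \<open>k\<close> of the given rows,
  hence the rotation of the list of differences. The two tie rules, one for the choice of
  \<open>l\<close> and one for the choice of a candidate of minimum length, are arbitrary.
\<close>

definition DPillarMin ::
  "(nat \<times> nat) tie_rule \<Rightarrow> powers tie_rule \<Rightarrow> nat \<Rightarrow> server \<Rightarrow> server \<Rightarrow> move list timed" where
  "DPillarMin gap_tie path_tie k = (\<lambda>(c, u) (c', w). do {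
     tick;
     ds \<leftarrow> differences u w;
     (xs, ys) \<leftarrow> split_list c ds;
     ds' \<leftarrow> append_list ys xs;
     Bs \<leftarrow> positions 0 ds';
     let x = (c' + k - c) mod k;
     \<Delta>\<^sub>0 \<leftarrow> occurs 0 Bs;
     \<Delta>x \<leftarrow> occurs x Bs;
     is \<leftarrow> select (\<lambda>i. x < i) Bs;
     js \<leftarrow> select (\<lambda>j. 0 < j \<and> j < x) Bs;
     cands \<leftarrow>
       (if x = 0 then same_column_candidates gap_tie k \<Delta>\<^sub>0 is
        else do {
          upper \<leftarrow> upper_candidates gap_tie k x \<Delta>x is;
          lower \<leftarrow> lower_candidates gap_tie k x \<Delta>\<^sub>0 js;
          return ([(k + x, [(C, k + x)]), (2 * k - x, [(A, 2 * k - x)])] @ upper @ lower)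
        });
     (L, p) \<leftarrow> best_candidate path_tie (hd cands) (tl cands);
     spell_out p
   })"

end

theory Submission
  imports Defs
begin

text \<open>
  Cut the cycle of columns open: a walk from column \<open>c\<close> becomes a walk on the integers that
  starts at \<open>0\<close> and ends at some \<open>y\<close>, and the position \<open>c + z\<close> modulo \<open>k\<close> becomes the unit
  interval between \<open>z\<close> and \<open>z + 1\<close>. The c- and a-edges traverse these intervals, and the b- and
  d-edges cover an adjacent one without moving. A walk whose range of columns is \<open>[m, M]\<close> makes
  at least \<open>2 * (M - m) - \<bar>y\<bar>\<close> moves, since it visits both ends, and the only positions it can
  cover without traversing them are the ones immediately beyond the two ends, at the price of one
  edge each. So every walk costs at least \<open>2 * (M - m) - \<bar>y\<bar> + \<alpha> + \<beta>\<close> and covers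
  \<open>[m - \<alpha>, M + \<beta>)\<close> at most, for some \<open>\<alpha>\<close> and \<open>\<beta>\<close> in \<open>{0, 1}\<close>. If \<open>M - m < k\<close>, then \<open>y\<close> is \<open>x\<close> or
  \<open>x - k\<close>, and the positions that have to be covered either all lie below \<open>M + \<beta>\<close>, or all lie
  from \<open>k + m - \<alpha>\<close> on, or skip a gap between two neighbours; each case is matched by a candidate.
  If \<open>M - m \<ge> k\<close>, one of \<open>c\<^sup>k\<^sup>+\<^sup>x\<close> and \<open>a\<^sup>2\<^sup>k\<^sup>-\<^sup>x\<close> is as good, or, for \<open>x = 0\<close>, some
  candidate of length at most \<open>k\<close>.
\<close>

section \<open>Results and step counts of the list operations\<close>

lemma result_return [simp]: "result (return a) = a"
  and steps_return [simp]: "steps (return a) = 0"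
  by (simp_all add: return_def)

lemma steps_tick [simp]: "steps tick = 1"
  by (simp add: tick_def)

lemma result_bind [simp]: "result (bind_timed m f) = result (f (result m))"
  and steps_bind [simp]: "steps (bind_timed m f) = steps m + steps (f (result m))"
  by (simp_all add: bind_timed_def)

lemma differences_timed:
  "length u = length w \<Longrightarrow> result (differences u w) = map2 (\<noteq>) u w \<and> steps (differences u w) = length u + 1"
  by (induction u w rule: list_induct2) auto

lemma split_list_timed:
  "m \<le> length as \<Longrightarrow> result (split_list m as) = (take m as, drop m as) \<and> steps (split_list m as) = m + 1"
  by (induction m as rule: split_list.induct) (auto split: prod.splits)

lemma append_list_timed:
  "result (append_list xs ys) = xs @ ys \<and> steps (append_list xs ys) = length xs + 1"
  by (induction xs ys rule: append_list.induct) auto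

lemma steps_positions: "steps (positions i ds) = length ds + 1"
  by (induction i ds rule: positions.induct) auto

lemma set_positions: "set (result (positions i ds)) = {i + j |j. j < length ds \<and> ds ! j}"
proof (induction i ds rule: positions.induct)
  case (2 i d ds)
  have "{i + j |j. j < length (d # ds) \<and> (d # ds) ! j}
    = (if d then {i} else {}) \<union> {i + 1 + j |j. j < length ds \<and> ds ! j}"
    by (auto simp: nth_Cons gr0_conv_Suc split: nat.splits)
  with 2 show ?case by auto
qed auto

lemma length_positions: "length (result (positions i ds)) \<le> length ds"
  by (induction i ds rule: positions.induct) auto

lemma sorted_positions: "sorted_wrt (<) (result (positions i ds))"
proof (induction i ds rule: positions.induct)
  case (2 i d ds)
  moreover have "\<forall>j\<in>set (result (positions (i + 1) ds)). i < j"
    unfolding set_positions by auto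
  ultimately show ?case by auto
qed auto

lemma select_timed:
  "result (select P is) = filter P is \<and> steps (select P is) = length is + 1"
  by (induction P "is" rule: select.induct) auto

lemma result_occurs: "result (occurs x is) = of_bool (x \<in> set is)"
  by (induction x "is" rule: occurs.induct) auto

lemma steps_occurs: "steps (occurs x is) \<le> length is + 1"
  by (induction x "is" rule: occurs.induct) auto

lemma last_of_timed:
  "result (last_of i js) = last (i # js) \<and> steps (last_of i js) = length js + 1"
  by (induction i js rule: last_of.induct) auto

lemma steps_widest_gap: "steps (widest_gap tie g js) \<le> length js + 1"
  by (induction tie g js rule: widest_gap.induct) auto

lemma widest_gap_mem:
  "result (widest_gap tie g js) \<in> insert g (set (zip js (tl js)))"
  by (induction tie g js rule: widest_gap.induct) auto

lemma widest_gap_max: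
  "(p, q) \<in> insert g (set (zip js (tl js))) \<Longrightarrow>
    q - p \<le> snd (result (widest_gap tie g js)) - fst (result (widest_gap tie g js))"
proof (induction tie g js arbitrary: p q rule: widest_gap.induct)
  case (1 tie p' q' i j js)
  let ?g = "if q' - p' < j - i \<or> j - i = q' - p' \<and> tie (p', q') (i, j) then (i, j) else (p', q')"
  have IH: "b - a \<le> snd (result (widest_gap tie ?g (j # js))) - fst (result (widest_gap tie ?g (j # js)))"
    if "(a, b) \<in> insert ?g (set (zip (j # js) (tl (j # js))))" for a b
    using 1(1)[OF that] .
  from 1(2) consider "(p, q) = (p', q') \<or> (p, q) = (i, j)"
    | "(p, q) \<in> set (zip (j # js) (tl (j # js)))" by auto
  then show ?case
  proof cases
    case 1
    \<comment> \<open>The new accumulator \<open>?g\<close> is at least as wide as both pairs it was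
      chosen from, so the bound for \<open>?g\<close> itself suffices.\<close>
    with IH[of "fst ?g" "snd ?g"] show ?thesis by (auto split: if_splits)
  next
    case 2
    with IH[of p q] show ?thesis by simp
  qed
qed auto

section \<open>Words as lists of powers, and the best candidate\<close>

definition exponent_sum :: "powers \<Rightarrow> nat" where
  "exponent_sum p = sum_list (map snd p)"

definition word :: "powers \<Rightarrow> move list" where
  "word p = concat (map (\<lambda>(m, e). replicate e m) p)"

lemma length_word: "length (word p) = exponent_sum p"
  unfolding word_def exponent_sum_def by (induction p) auto

lemma prepend_power_timed:
  "result (prepend_power m e w) = replicate e m @ w \<and> steps (prepend_power m e w) = e + 1"
  by (induction m e w rule: prepend_power.induct) (auto simp: replicate_app_Cons_same)

lemma spell_out_timed:
  "result (spell_out p) = word p \<and> steps (spell_out p) = exponent_sum p + 2 * length p + 1"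
  by (induction p rule: spell_out.induct) (auto simp: prepend_power_timed word_def exponent_sum_def)

lemma steps_best_candidate: "steps (best_candidate tie x xs) = length xs + 1"
  by (induction tie x xs rule: best_candidate.induct) auto

lemma best_candidate_mem: "result (best_candidate tie x xs) \<in> insert x (set xs)"
  by (induction tie x xs rule: best_candidate.induct) auto

lemma best_candidate_min:
  "y \<in> insert x (set xs) \<Longrightarrow> fst (result (best_candidate tie x xs)) \<le> fst y"
proof (induction tie x xs arbitrary: y rule: best_candidate.induct)
  case (2 tie L p L' p' cands)
  let ?x = "if L' < L \<or> L' = L \<and> tie p p' then (L', p') else (L, p)"
  have IH: "fst (result (best_candidate tie ?x cands)) \<le> fst y" if "y \<in> insert ?x (set cands)" for y
    using 2(1)[OF that] .
  from 2(2) consider "y = (L, p) \<or> y = (L', p')" | "y \<in> set cands" by auto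
  then show ?case
  proof cases
    case 1
    with IH[of ?x] show ?thesis by (auto split: if_splits)
  next
    case 2
    with IH[of y] show ?thesis by simp
  qed
qed auto

section \<open>Neighbouring entries of increasing lists\<close>

lemma sorted_adjacent:
  assumes "sorted_wrt (<) (l :: nat list)" "(p, q) \<in> set (zip l (tl l))"
  shows "p \<in> set l" "q \<in> set l" "p < q" "\<forall>i\<in>set l. i \<le> p \<or> q \<le> i"
proof -
  show "p \<in> set l" using assms(2) by (rule set_zip_leftD)
  show "q \<in> set l" using set_zip_rightD[OF assms(2)] by (metis list.sel(2) list.set_sel(2))
  from assms show "p < q"
    by (induction l rule: induct_list012) auto
  from assms show "\<forall>i\<in>set l. i \<le> p \<or> q \<le> i"
  proof (induction l rule: induct_list012)
    case (3 i j l)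
    show ?case
    proof (cases "(p, q) = (i, j)")
      case False
      with 3(4) have pq: "(p, q) \<in> set (zip (j # l) (tl (j # l)))" by auto
      then have "p \<in> set (j # l)" by (rule set_zip_leftD)
      with 3(3) have "i < p" by auto
      with 3(2)[OF _ pq] 3(3) show ?thesis by auto
    qed (use 3(3) in auto)
  qed auto
qed

text \<open>Look at the first entry that is at least \<open>b\<close>. All later entries are as
  well, and all earlier ones must be less than \<open>a\<close>; so either there is no such entry,
  or it is the head, or it has a predecessor. This turns the positions missed by a walk into the
  case distinction behind the candidates.\<close>

lemma threshold_adjacent:
  assumes "sorted_wrt (<) (l :: nat list)" "\<forall>i\<in>set l. int i < a \<or> b \<le> int i"
  shows "(\<forall>i\<in>set l. int i < a) \<or> (\<forall>i\<in>set l. b \<le> int i) \<or>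
    (\<exists>(p, q)\<in>set (zip l (tl l)). int p < a \<and> b \<le> int q)"
  using assms
proof (induction l rule: induct_list012)
  case (3 i j l)
  show ?case
  proof (cases "b \<le> int i")
    case True
    have "\<forall>y\<in>set (i # j # l). b \<le> int y"
    proof
      fix y assume "y \<in> set (i # j # l)"
      with 3(3) have "i \<le> y" by auto
      with True show "b \<le> int y" by linarith
    qed
    then show ?thesis by blast
  next
    case False
    with 3(4) have i: "int i < a" by auto
    show ?thesis
    proof (cases "b \<le> int j")
      case True
      with i show ?thesis by auto
    next
      case False
      with 3 i show ?thesis by auto
    qed
  qed
qed auto

section \<open>Candidates on the line\<close>

lemma sorted_le_last: "sorted_wrt (<) (l :: nat list) \<Longrightarrow> b \<in> set l \<Longrightarrow> b \<le> last l"
  by (induction l) (auto simp: less_le)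

text \<open>The fourth fact, that nothing lies strictly inside the gap, makes the gap candidate
  valid; the fifth, that no gap is wider, makes it optimal.\<close>

lemma widest_gap_neighbours:
  assumes "sorted_wrt (<) (i # j # l)" "result (widest_gap tie (i, j) (j # l)) = (p, q)"
  shows "p \<in> set (i # j # l)" "q \<in> set (i # j # l)" "p < q"
    "b \<in> set (i # j # l) \<Longrightarrow> b \<le> p \<or> q \<le> b"
    "(a, b) \<in> set (zip (i # j # l) (tl (i # j # l))) \<Longrightarrow> b - a \<le> q - p"
proof -
  have "(p, q) \<in> set (zip (i # j # l) (tl (i # j # l)))"
    using widest_gap_mem[of tie "(i, j)" "j # l"] assms(2) by simp
  note * = sorted_adjacent[OF assms(1) this]
  show "p \<in> set (i # j # l)" "q \<in> set (i # j # l)" "p < q"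
    "b \<in> set (i # j # l) \<Longrightarrow> b \<le> p \<or> q \<le> b" using * by blast+
  show "(a, b) \<in> set (zip (i # j # l) (tl (i # j # l))) \<Longrightarrow> b - a \<le> q - p"
    using widest_gap_max[of a b "(i, j)" "j # l" tie] assms(2) by simp
qed

text \<open>
  The word \<open>p\<close>, used on the line by a walk that stands at \<open>z\<close> and has covered \<open>[lo, hi)\<close>, ends
  in column \<open>x\<close> modulo \<open>k\<close> with all of \<open>S\<close> covered, and its b- and d-edges change a bit. These
  conditions are linear, with only the residues of \<open>x\<close>, \<open>S\<close> and the arguments of b and d that the
  candidates need.
\<close>

fun reaches :: "nat \<Rightarrow> nat \<Rightarrow> nat set \<Rightarrow> int \<Rightarrow> int \<Rightarrow> int \<Rightarrow> powers \<Rightarrow> bool" where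
  "reaches k x S lo z hi [] \<longleftrightarrow>
    z \<in> {int x, int x - int k, int x + int k, int x - 2 * int k} \<and>
    (\<forall>b\<in>S. (lo \<le> int b \<and> int b < hi) \<or> (lo \<le> int b - int k \<and> int b - int k < hi))"
| "reaches k x S lo z hi ((C, e) # p) \<longleftrightarrow> reaches k x S lo (z + int e) (max hi (z + int e)) p"
| "reaches k x S lo z hi ((A, e) # p) \<longleftrightarrow> reaches k x S (min lo (z - int e)) (z - int e) hi p"
| "reaches k x S lo z hi ((B, e) # p) \<longleftrightarrow>
    e = 0 \<and> reaches k x S lo z hi p \<or>
    e = 1 \<and> z = hi \<and> hi - lo < int k \<and> 0 \<le> z \<and> nat z \<in> S \<and>
      reaches k x S lo z (hi + 1) p"
| "reaches k x S lo z hi ((D, e) # p) \<longleftrightarrow>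
    e = 0 \<and> reaches k x S lo z hi p \<or>
    e = 1 \<and> z = lo \<and> hi - lo < int k \<and> 0 \<le> z - 1 + int k \<and> nat (z - 1 + int k) \<in> S \<and>
      reaches k x S (lo - 1) z hi p"

text \<open>The bounds \<open>4 * k\<close> and \<open>5\<close> serve the step count: spelling out
  a candidate takes time linear in its length and its number of factors.\<close>

definition valid_candidate :: "nat \<Rightarrow> nat \<Rightarrow> nat set \<Rightarrow> candidate \<Rightarrow> bool" where
  "valid_candidate k x S = (\<lambda>(L, p). exponent_sum p = L \<and> L \<le> 4 * k \<and> length p \<le> 5 \<and>
    reaches k x S 0 0 0 p)"

section \<open>Each candidate covers what it must\<close>

text \<open>On the line the words cover \<open>[0, x + \<Delta>)\<close> if the list is empty,
  otherwise \<open>[i - k, x + \<Delta>)\<close> for the least entry, \<open>[0, i + 1)\<close> for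
  the last and \<open>[q - k, p + 1)\<close> for the widest gap; all of them end at
  \<open>x\<close>. A d-edge at the lower end or a b-edge at the upper end saves traversing the
  outermost position twice.\<close>

lemma upper_candidates_valid:
  assumes k: "0 < x" "x < k" and S: "\<forall>i\<in>S. i < k"
    and l: "sorted_wrt (<) l" "set l = {i\<in>S. x < i}"
    and \<Delta>: "\<Delta> = of_bool (x \<in> S)"
    and cand: "cand \<in> set (result (upper_candidates tie k x \<Delta> l))"
  shows "valid_candidate k x S cand"
proof -
  have le: "i \<in> set l \<Longrightarrow> x < i \<and> i < k \<and> i \<in> S" for i using l(2) S by blast
  have mem: "b \<in> S \<Longrightarrow> b < x \<or> b = x \<or> b \<in> set l" for b
    using l(2) by (cases b x rule: linorder_cases) blast+
  have \<Delta>_le: "\<Delta> = 0 \<or> \<Delta> = 1"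
    using \<Delta> by simp
  have \<Delta>_mem: "x \<in> S" if "\<Delta> = 1"
    using \<Delta> that by (metis of_bool_eq(1) zero_neq_one)
  have first_valid: "valid_candidate k x S (2 * k - 2 * i + x - 1 + \<Delta>,
      [(A, k - i - 1), (D, 1), (C, k - i - 1 + x), (B, \<Delta>)])"
    if "i \<in> set l" "\<forall>b\<in>set l. i \<le> b" for i
  proof -
    have i: "x < i" "i < k" "i \<in> S" using le[OF that(1)] by auto
    \<comment> \<open>This locates \<open>S\<close> relative to the covered range; used as a
      destruction rule, it leaves only linear arithmetic in \<open>reaches\<close>.\<close>
    have b: "b < x + \<Delta> \<or> i \<le> b \<and> b < k" if "b \<in> S" for b
      using mem[OF that] le[of b] \<open>\<forall>b\<in>set l. i \<le> b\<close> that \<Delta> by auto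
    show ?thesis
      using i(1,2) k \<Delta>_le unfolding valid_candidate_def exponent_sum_def
      by (auto simp: of_nat_diff max_def min_def dest!: b simp: i(3) \<Delta>_mem)
  qed
  have last_valid: "valid_candidate k x S (2 * i - x + 1, [(C, i), (B, 1), (A, i - x)])"
    if "i \<in> set l" "\<forall>b\<in>set l. b \<le> i" for i
  proof -
    have i: "x < i" "i < k" "i \<in> S" using le[OF that(1)] by auto
    have b: "b \<le> i" if "b \<in> S" for b
      using mem[OF that] le[of b] \<open>\<forall>b\<in>set l. b \<le> i\<close> that i by auto
    show ?thesis
      using i(1,2) k unfolding valid_candidate_def exponent_sum_def
      by (auto simp: of_nat_diff max_def min_def dest!: b simp: i(3))
  qed
  show ?thesis
  \<comment> \<open>The rule separates lists with none, one and at least two entries, as the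
    equations for the candidates do.\<close>
  proof (cases l rule: remdups_adj.cases)
    case 1
    then have "l = []" by simp
    then have b: "b < x + \<Delta>" if "b \<in> S" for b using mem[OF that] that \<Delta> by auto
    show ?thesis using cand \<open>l = []\<close> k \<Delta>_le unfolding valid_candidate_def exponent_sum_def
      by (auto simp: max_def dest!: b simp: \<Delta>_mem)
  next
    case (2 i)
    then have "l = [i]" by simp
    with cand have "cand = (2 * k - 2 * i + x - 1 + \<Delta>, [(A, k - i - 1), (D, 1), (C, k - i - 1 + x), (B, \<Delta>)])
      \<or> cand = (2 * i - x + 1, [(C, i), (B, 1), (A, i - x)])" by simp
    with first_valid[of i] last_valid[of i] \<open>l = [i]\<close> show ?thesis by auto
  next
    case (3 i j l')
    then have lij: "l = i # j # l'" by simp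
    obtain p q where pq: "result (widest_gap tie (i, j) (j # l')) = (p, q)" by fastforce
    note gap = widest_gap_neighbours[OF l(1)[unfolded lij] pq, folded lij]
    have p: "x < p" "p < k" "p \<in> S" and q: "x < q" "q < k" "q \<in> S" "p < q"
      using gap(1-3) le by auto
    have b: "b \<le> p \<or> q \<le> b \<and> b < k" if "b \<in> S" for b
      using mem[OF that] le[of b] gap(4)[of b] that p by auto
    have "valid_candidate k x S
      (2 * k - 2 * (q - p) - x, [(A, k - q - 1), (D, 1), (C, k - q - 1 + p), (B, 1), (A, p - x)])"
      using p(1,2) q(1,2,4) k unfolding valid_candidate_def exponent_sum_def
      by (auto simp: of_nat_diff max_def min_def dest!: b simp: p(3) q(3))
    moreover have "\<forall>b\<in>set l. i \<le> b" using l(1) lij by auto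
    moreover have "\<forall>b\<in>set l. b \<le> last (j # l')"
      using sorted_le_last[OF l(1)] lij by simp
    ultimately show ?thesis using cand first_valid[of i] last_valid[of "last (j # l')"] lij pq
      by (auto simp: last_of_timed split: if_splits)
  qed
qed


text \<open>These walks end at \<open>x - k\<close>. Their ranges are
  \<open>[x - k, \<Delta>)\<close> for the empty list, \<open>[j - k, \<Delta>)\<close> for the
  least entry, \<open>[x - k, j + 1)\<close> for the last and \<open>[q - k, p + 1)\<close> for the
  widest gap, so all positions from \<open>x\<close> on are covered along the way.\<close>

lemma lower_candidates_valid:
  assumes k: "0 < x" "x < k" and S: "\<forall>i\<in>S. i < k"
    and l: "sorted_wrt (<) l" "set l = {j\<in>S. 0 < j \<and> j < x}"
    and \<Delta>: "\<Delta> = of_bool (0 \<in> S)"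
    and cand: "cand \<in> set (result (lower_candidates tie k x \<Delta> l))"
  shows "valid_candidate k x S cand"
proof -
  have le: "i \<in> set l \<Longrightarrow> 0 < i \<and> i < x \<and> i \<in> S" for i using l(2) S by blast
  have mem: "b \<in> S \<Longrightarrow> b = 0 \<or> b \<in> set l \<or> x \<le> b" for b
    using l(2) by (cases b x rule: linorder_cases) auto
  have \<Delta>_le: "\<Delta> = 0 \<or> \<Delta> = 1"
    using \<Delta> by simp
  have \<Delta>_mem: "0 \<in> S" if "\<Delta> = 1"
    using \<Delta> that by (metis of_bool_eq(1) zero_neq_one)
  have first_valid: "valid_candidate k x S (k + x - 2 * j - 1 + \<Delta>,
      [(B, \<Delta>), (A, k - j - 1), (D, 1), (C, x - j - 1)])"
    if "j \<in> set l" "\<forall>b\<in>set l. j \<le> b" for j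
  proof -
    have j: "0 < j" "j < x" "j \<in> S" using le[OF that(1)] by auto
    have b: "b < \<Delta> \<or> j \<le> b \<and> b < k" if "b \<in> S" for b
      using mem[OF that] S j \<open>\<forall>b\<in>set l. j \<le> b\<close> that \<Delta> by auto
    show ?thesis
      using j(1,2) k \<Delta>_le unfolding valid_candidate_def exponent_sum_def
      by (auto simp: of_nat_diff max_def min_def dest!: b simp: j(3) \<Delta>_mem)
  qed
  have last_valid: "valid_candidate k x S (k + 2 * j - x + 1, [(C, j), (B, 1), (A, k + j - x)])"
    if "j \<in> set l" "\<forall>b\<in>set l. b \<le> j" for j
  proof -
    have j: "0 < j" "j < x" "j \<in> S" using le[OF that(1)] by auto
    have b: "b \<le> j \<or> x \<le> b \<and> b < k" if "b \<in> S" for b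
      using mem[OF that] S \<open>\<forall>b\<in>set l. b \<le> j\<close> that j by auto
    show ?thesis
      using j(1,2) k unfolding valid_candidate_def exponent_sum_def
      by (auto simp: of_nat_diff max_def min_def dest!: b simp: j(3))
  qed
  show ?thesis
  proof (cases l rule: remdups_adj.cases)
    case 1
    then have "l = []" by simp
    then have b: "b < \<Delta> \<or> x \<le> b \<and> b < k" if "b \<in> S" for b using mem[OF that] that S \<Delta> by auto
    show ?thesis using cand \<open>l = []\<close> k \<Delta>_le unfolding valid_candidate_def exponent_sum_def
      by (auto simp: of_nat_diff max_def min_def dest!: b simp: \<Delta>_mem)
  next
    case (2 j)
    then have "l = [j]" by simp
    with cand have "cand = (k + x - 2 * j - 1 + \<Delta>, [(B, \<Delta>), (A, k - j - 1), (D, 1), (C, x - j - 1)])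
      \<or> cand = (k + 2 * j - x + 1, [(C, j), (B, 1), (A, k + j - x)])" by simp
    with first_valid[of j] last_valid[of j] \<open>l = [j]\<close> show ?thesis by auto
  next
    case (3 i j l')
    then have lij: "l = i # j # l'" by simp
    obtain p q where pq: "result (widest_gap tie (i, j) (j # l')) = (p, q)" by fastforce
    note gap = widest_gap_neighbours[OF l(1)[unfolded lij] pq, folded lij]
    have p: "0 < p" "p < x" "p \<in> S" and q: "0 < q" "q < x" "q \<in> S" "p < q"
      using gap(1-3) le by auto
    have b: "b \<le> p \<or> q \<le> b \<and> b < k" if "b \<in> S" for b
      using mem[OF that] S gap(4)[of b] that p q by auto
    have "valid_candidate k x S
      (k + x - 2 * (q - p), [(C, p), (B, 1), (A, p + k - q - 1), (D, 1), (C, x - q - 1)])"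
      using p(1,2) q(1,2,4) k unfolding valid_candidate_def exponent_sum_def
      by (auto simp: of_nat_diff max_def min_def dest!: b simp: p(3) q(3))
    moreover have "\<forall>b\<in>set l. i \<le> b" using l(1) lij by auto
    moreover have "\<forall>b\<in>set l. b \<le> last (j # l')"
      using sorted_le_last[OF l(1)] lij by simp
    ultimately show ?thesis using cand first_valid[of i] last_valid[of "last (j # l')"] lij pq
      by (auto simp: last_of_timed add.commute split: if_splits)
  qed
qed

lemma same_column_candidates_valid:
  assumes k: "2 \<le> k" and S: "\<forall>i\<in>S. i < k" "S \<noteq> {}"
    and l: "sorted_wrt (<) l" "set l = {i\<in>S. 0 < i}"
    and \<Delta>: "\<Delta> = of_bool (0 \<in> S)"
    and cand: "cand \<in> set (result (same_column_candidates tie k \<Delta> l))"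
  shows "valid_candidate k 0 S cand"
proof -
  have le: "i \<in> set l \<Longrightarrow> 0 < i \<and> i < k \<and> i \<in> S" for i using l(2) S by blast
  have mem: "b \<in> S \<Longrightarrow> b = 0 \<or> b \<in> set l" for b
    using l(2) by auto
  have \<Delta>_le: "\<Delta> = 0 \<or> \<Delta> = 1"
    using \<Delta> by simp
  have \<Delta>_mem: "0 \<in> S" if "\<Delta> = 1"
    using \<Delta> that by (metis of_bool_eq(1) zero_neq_one)
  have first_valid: "valid_candidate k 0 S (2 * k - 2 * i - 1 + \<Delta>,
      [(B, \<Delta>), (A, k - i - 1), (D, 1), (C, k - i - 1)])"
    if "i \<in> set l" "\<forall>b\<in>set l. i \<le> b" for i
  proof -
    have i: "0 < i" "i < k" "i \<in> S" using le[OF that(1)] by auto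
    have b: "b < \<Delta> \<or> i \<le> b \<and> b < k" if "b \<in> S" for b
      using mem[OF that] S i \<open>\<forall>b\<in>set l. i \<le> b\<close> that \<Delta> by auto
    show ?thesis
      using i(1,2) k \<Delta>_le unfolding valid_candidate_def exponent_sum_def
      by (auto simp: of_nat_diff max_def min_def dest!: b simp: i(3) \<Delta>_mem)
  qed
  have last_valid: "valid_candidate k 0 S (2 * i + 1, [(C, i), (B, 1), (A, i)])"
    if "i \<in> set l" "\<forall>b\<in>set l. b \<le> i" for i
  proof -
    have i: "0 < i" "i < k" "i \<in> S" using le[OF that(1)] by auto
    have b: "b \<le> i" if "b \<in> S" for b
      using mem[OF that] S \<open>\<forall>b\<in>set l. b \<le> i\<close> that i by auto
    show ?thesis
      using i(1,2) k unfolding valid_candidate_def exponent_sum_def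
      by (auto simp: of_nat_diff max_def min_def dest!: b simp: i(3))
  qed
  show ?thesis
  proof (cases l rule: remdups_adj.cases)
    case 1
    then have "l = []" by simp
    then have b: "b = 0" if "b \<in> S" for b using mem[OF that] that by auto
    \<comment> \<open>The single b-edge is legal only because bit \<open>0\<close> differs.\<close>
    with S(2) have "0 \<in> S" by auto
    show ?thesis using cand \<open>l = []\<close> k unfolding valid_candidate_def exponent_sum_def
      by (auto dest!: b simp: \<open>0 \<in> S\<close>)
  next
    case (2 i)
    then have l: "l = [i]" by simp
    with le have i: "0 < i" "i < k" "i \<in> S" by auto
    \<comment> \<open>The two short words are instances of the general ones: for
      \<open>i = k - 1\<close> the exponents \<open>k - i - 1\<close> vanish, and \<open>3\<close>
      is \<open>2 * i + 1\<close> for \<open>i = 1\<close>.\<close>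
    have "valid_candidate k 0 S (1 + \<Delta>, [(B, \<Delta>), (D, 1)])" if "i = k - 1"
      using first_valid[of i] l i that by (simp add: valid_candidate_def exponent_sum_def)
    moreover have "valid_candidate k 0 S (3, [(C, 1), (B, 1), (A, 1)])" if "i = 1"
      using last_valid[of i] l that by (simp add: numeral_3_eq_3)
    ultimately show ?thesis using cand first_valid[of i] last_valid[of i] l by (auto split: if_splits)
  next
    case (3 i j l')
    then have lij: "l = i # j # l'" by simp
    obtain p q where pq: "result (widest_gap tie (i, j) (j # l')) = (p, q)" by fastforce
    note gap = widest_gap_neighbours[OF l(1)[unfolded lij] pq, folded lij]
    have p: "0 < p" "p < k" "p \<in> S" and q: "0 < q" "q < k" "q \<in> S" "p < q"
      using gap(1-3) le by auto
    have b: "b \<le> p \<or> q \<le> b \<and> b < k" if "b \<in> S" for b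
      using mem[OF that] S gap(4)[of b] that p q by auto
    have "valid_candidate k 0 S
      (2 * k - 2 * (q - p), [(A, k - q - 1), (D, 1), (C, k - q - 1 + p), (B, 1), (A, p)])"
      using p(1,2) q(1,2,4) k unfolding valid_candidate_def exponent_sum_def
      by (auto simp: of_nat_diff max_def min_def dest!: b simp: p(3) q(3))
    moreover have "valid_candidate k 0 S (k, [(C, k)])"
      using S(1) by (auto simp: valid_candidate_def exponent_sum_def)
    moreover have "\<forall>b\<in>set l. i \<le> b" using l(1) lij by auto
    moreover have "\<forall>b\<in>set l. b \<le> last (j # l')"
      using sorted_le_last[OF l(1)] lij by simp
    ultimately show ?thesis using cand first_valid[of i] last_valid[of "last (j # l')"] lij pq
      by (auto simp: last_of_timed split: if_splits)
  qed
qed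

section \<open>No walk of small range beats the candidates\<close>

text \<open>By \<open>cov\<close>, no position of \<open>S\<close> lies in the hole
  \<open>[M + \<beta>, k + m - \<alpha>)\<close>. So the list lies below the hole, above it, or
  around it with two neighbours on its two sides, matching the last, first and gap candidates. In
  the cost, \<open>\<alpha>\<close> and \<open>\<beta>\<close> replace a traversal counted twice, so
  each saves at most one.\<close>

lemma upper_candidates_optimal:
  fixes M m \<alpha> \<beta> :: int
  assumes k: "0 < x" "x < k" and S: "\<forall>i\<in>S. i < k"
    and l: "sorted_wrt (<) l" "set l = {i\<in>S. x < i}"
    and \<Delta>: "\<Delta> = of_bool (x \<in> S)"
    and span: "m \<le> 0" "int x \<le> M" "0 \<le> \<alpha>" "\<alpha> \<le> 1" "0 \<le> \<beta>" "\<beta> \<le> 1"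
    and cov: "\<forall>b\<in>S. int b < M + \<beta> \<or> int k + m - \<alpha> \<le> int b"
  shows "\<exists>cand\<in>set (result (upper_candidates tie k x \<Delta> l)).
    int (fst cand) \<le> 2 * (M - m) - int x + \<alpha> + \<beta>"
proof -
  have le: "i \<in> set l \<Longrightarrow> x < i \<and> i < k \<and> i \<in> S" for i using l(2) S by blast
  \<comment> \<open>If the bit at \<open>x\<close> differs, some end must go beyond it: the upper
    one past \<open>x\<close>, or the lower one as far down as \<open>x - k\<close>, which is more
    than any entry of the list demands. Either way the cost absorbs \<open>\<Delta>\<close>.\<close>
  have \<Delta>_cov: "\<Delta> = 0 \<or> \<Delta> = 1 \<and> (int x < M + \<beta> \<or> int k + m - \<alpha> \<le> int x)"
    using \<Delta> cov by (cases "x \<in> S") auto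
  have first_le: "int (2 * k - 2 * i + x - 1 + \<Delta>) \<le> 2 * (M - m) - int x + \<alpha> + \<beta>"
    if "i \<in> set l" "int k + m - \<alpha> \<le> int i" for i
    using le[OF that(1)] that(2) \<Delta>_cov span k by (auto simp: of_nat_diff)
  have last_le: "int (2 * i - x + 1) \<le> 2 * (M - m) - int x + \<alpha> + \<beta>"
    if "i \<in> set l" "int i < M + \<beta>" for i
    using le[OF that(1)] that(2) span k by (auto simp: of_nat_diff)
  show ?thesis
  proof (cases l rule: remdups_adj.cases)
    case 1
    with \<Delta>_cov span k show ?thesis by auto
  next
    case (2 i)
    with cov le have "int i < M + \<beta> \<or> int k + m - \<alpha> \<le> int i" by auto
    with first_le[of i] last_le[of i] 2 show ?thesis by auto
  next
    case (3 i j l')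
    obtain p q where pq: "result (widest_gap tie (i, j) (j # l')) = (p, q)" by fastforce
    note gap = widest_gap_neighbours[OF l(1)[unfolded 3] pq, folded 3]
    from cov le have "\<forall>b\<in>set l. int b < M + \<beta> \<or> int k + m - \<alpha> \<le> int b" by auto
    from threshold_adjacent[OF l(1) this] consider
      "\<forall>b\<in>set l. int b < M + \<beta>" | "\<forall>b\<in>set l. int k + m - \<alpha> \<le> int b"
      | a b where "(a, b) \<in> set (zip l (tl l))" "int a < M + \<beta>" "int k + m - \<alpha> \<le> int b"
      by auto
    then show ?thesis
    proof cases
      case 1
      have "last (j # l') \<in> set l" using 3 last_in_set[of "j # l'"] by auto
      with 1 last_le[of "last (j # l')"] 3 pq show ?thesis by (auto simp: last_of_timed split: if_splits)
    next
      case 2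
      with first_le[of i] 3 pq show ?thesis by auto
    next
      case c: 3
      note ab = sorted_adjacent[OF l(1) c(1)]
      \<comment> \<open>The walk may skip a different gap, but the candidate skips a widest one and
        is no longer.\<close>
      have "b - a \<le> q - p" using gap(5) c(1) .
      moreover have "q < k" "x < p" using le gap(1,2) by auto
      ultimately have "int (2 * k - 2 * (q - p) - x) \<le> 2 * (M - m) - int x + \<alpha> + \<beta>"
        using c(2,3) span ab(3) gap(3) by (auto simp: of_nat_diff)
      with 3 pq show ?thesis by auto
    qed
  qed
qed

text \<open>The counterpart for a walk ending at \<open>x - k\<close>, where the deducted distance
  is \<open>k - x\<close>. Reaching \<open>x - k\<close> covers the positions from \<open>x\<close>
  on, so only those strictly between \<open>0\<close> and \<open>x\<close> decide, and the extra
  move is for position \<open>0\<close>.\<close>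

lemma lower_candidates_optimal:
  fixes M m \<alpha> \<beta> :: int
  assumes k: "0 < x" "x < k"
    and l: "sorted_wrt (<) l" "set l = {j\<in>S. 0 < j \<and> j < x}"
    and \<Delta>: "\<Delta> = of_bool (0 \<in> S)"
    and span: "m \<le> int x - int k" "0 \<le> M" "0 \<le> \<alpha>" "\<alpha> \<le> 1" "0 \<le> \<beta>" "\<beta> \<le> 1"
    and cov: "\<forall>b\<in>S. int b < M + \<beta> \<or> int k + m - \<alpha> \<le> int b"
  shows "\<exists>cand\<in>set (result (lower_candidates tie k x \<Delta> l)).
    int (fst cand) \<le> 2 * (M - m) - (int k - int x) + \<alpha> + \<beta>"
proof -
  have le: "i \<in> set l \<Longrightarrow> 0 < i \<and> i < x \<and> i \<in> S" for i using l(2) by blast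
  have \<Delta>_cov: "\<Delta> = 0 \<or> \<Delta> = 1 \<and> (0 < M + \<beta> \<or> int k + m - \<alpha> \<le> 0)"
    using \<Delta> cov by (cases "0 \<in> S") auto
  have first_le: "int (k + x - 2 * j - 1 + \<Delta>) \<le> 2 * (M - m) - (int k - int x) + \<alpha> + \<beta>"
    if "j \<in> set l" "int k + m - \<alpha> \<le> int j" for j
    using le[OF that(1)] that(2) \<Delta>_cov span k by (auto simp: of_nat_diff)
  have last_le: "int (k + 2 * j - x + 1) \<le> 2 * (M - m) - (int k - int x) + \<alpha> + \<beta>"
    if "j \<in> set l" "int j < M + \<beta>" for j
    using le[OF that(1)] that(2) span k by (auto simp: of_nat_diff)
  show ?thesis
  proof (cases l rule: remdups_adj.cases)
    case 1
    with \<Delta>_cov span k show ?thesis by auto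
  next
    case (2 i)
    with cov le have "int i < M + \<beta> \<or> int k + m - \<alpha> \<le> int i" by auto
    with first_le[of i] last_le[of i] 2 show ?thesis by auto
  next
    case (3 i j l')
    obtain p q where pq: "result (widest_gap tie (i, j) (j # l')) = (p, q)" by fastforce
    note gap = widest_gap_neighbours[OF l(1)[unfolded 3] pq, folded 3]
    from cov le have "\<forall>b\<in>set l. int b < M + \<beta> \<or> int k + m - \<alpha> \<le> int b" by auto
    from threshold_adjacent[OF l(1) this] consider
      "\<forall>b\<in>set l. int b < M + \<beta>" | "\<forall>b\<in>set l. int k + m - \<alpha> \<le> int b"
      | a b where "(a, b) \<in> set (zip l (tl l))" "int a < M + \<beta>" "int k + m - \<alpha> \<le> int b"
      by auto
    then show ?thesis
    proof cases
      case 1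
      have "last (j # l') \<in> set l" using 3 last_in_set[of "j # l'"] by auto
      with 1 last_le[of "last (j # l')"] 3 pq show ?thesis by (auto simp: last_of_timed split: if_splits)
    next
      case 2
      with first_le[of i] 3 pq show ?thesis by auto
    next
      case c: 3
      note ab = sorted_adjacent[OF l(1) c(1)]
      have "b - a \<le> q - p" using gap(5) c(1) .
      moreover have "q < x" using le gap(2) by auto
      ultimately have "int (k + x - 2 * (q - p)) \<le> 2 * (M - m) - (int k - int x) + \<alpha> + \<beta>"
        using c(2,3) span ab(3) gap(3) k by (auto simp: of_nat_diff)
      with 3 pq show ?thesis by auto
    qed
  qed
qed

text \<open>For a walk that returns to \<open>0\<close> on the line nothing is deducted; position
  \<open>0\<close> takes the role that \<open>x\<close> has for the upper candidates.\<close>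

lemma same_column_candidates_optimal:
  fixes M m \<alpha> \<beta> :: int
  assumes k: "2 \<le> k" and S: "\<forall>i\<in>S. i < k" "S \<noteq> {}"
    and l: "sorted_wrt (<) l" "set l = {i\<in>S. 0 < i}"
    and \<Delta>: "\<Delta> = of_bool (0 \<in> S)"
    and span: "m \<le> 0" "0 \<le> M" "0 \<le> \<alpha>" "\<alpha> \<le> 1" "0 \<le> \<beta>" "\<beta> \<le> 1" "M - m < int k"
    and cov: "\<forall>b\<in>S. int b < M + \<beta> \<or> int k + m - \<alpha> \<le> int b"
  shows "\<exists>cand\<in>set (result (same_column_candidates tie k \<Delta> l)).
    int (fst cand) \<le> 2 * (M - m) + \<alpha> + \<beta>"
proof -
  have le: "i \<in> set l \<Longrightarrow> 0 < i \<and> i < k \<and> i \<in> S" for i using l(2) S by blast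
  have \<Delta>_cov: "\<Delta> = 0 \<or> \<Delta> = 1 \<and> (0 < M + \<beta> \<or> int k + m - \<alpha> \<le> 0)"
    using \<Delta> cov by (cases "0 \<in> S") auto
  have first_le: "int (2 * k - 2 * i - 1 + \<Delta>) \<le> 2 * (M - m) + \<alpha> + \<beta>"
    if "i \<in> set l" "int k + m - \<alpha> \<le> int i" for i
    using le[OF that(1)] that(2) \<Delta>_cov span k by (auto simp: of_nat_diff)
  have last_le: "int (2 * i + 1) \<le> 2 * (M - m) + \<alpha> + \<beta>"
    if "i \<in> set l" "int i < M + \<beta>" for i
    using le[OF that(1)] that(2) span k by (auto simp: of_nat_diff)
  show ?thesis
  proof (cases l rule: remdups_adj.cases)
    case 1
    with l(2) have "\<forall>b\<in>S. b = 0" by auto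
    with S(2) have "0 \<in> S" by auto
    with cov span 1 show ?thesis by auto
  next
    case (2 i)
    then have i: "0 < i" "i < k" using le by auto
    from cov le 2 have "int i < M + \<beta> \<or> int k + m - \<alpha> \<le> int i" by auto
    \<comment> \<open>For \<open>i = k - 1\<close> and for \<open>i = 1\<close> only one of the two
      usual lengths is present, but it is the smaller one:
      \<open>1 + \<Delta> \<le> 2 * i + 1\<close> in the first case, and
      \<open>3 \<le> 2 * k - 2 * i - 1 + \<Delta>\<close> in the second, where
      \<open>k \<ge> 3\<close>.\<close>
    with first_le[of i] last_le[of i] 2 i \<Delta>_cov show ?thesis by (auto simp: of_nat_diff)
  next
    case (3 i j l')
    obtain p q where pq: "result (widest_gap tie (i, j) (j # l')) = (p, q)" by fastforce
    note gap = widest_gap_neighbours[OF l(1)[unfolded 3] pq, folded 3]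
    from cov le have "\<forall>b\<in>set l. int b < M + \<beta> \<or> int k + m - \<alpha> \<le> int b" by auto
    from threshold_adjacent[OF l(1) this] consider
      "\<forall>b\<in>set l. int b < M + \<beta>" | "\<forall>b\<in>set l. int k + m - \<alpha> \<le> int b"
      | a b where "(a, b) \<in> set (zip l (tl l))" "int a < M + \<beta>" "int k + m - \<alpha> \<le> int b"
      by auto
    then show ?thesis
    proof cases
      case 1
      have "last (j # l') \<in> set l" using 3 last_in_set[of "j # l'"] by auto
      with 1 last_le[of "last (j # l')"] 3 pq show ?thesis by (auto simp: last_of_timed split: if_splits)
    next
      case 2
      with first_le[of i] 3 pq show ?thesis by auto
    next
      case c: 3
      note ab = sorted_adjacent[OF l(1) c(1)]
      have "b - a \<le> q - p" using gap(5) c(1) .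
      moreover have "q < k" using le gap(2) by auto
      ultimately have "int (2 * k - 2 * (q - p)) \<le> 2 * (M - m) + \<alpha> + \<beta>"
        using c(2,3) span ab(3) gap(3) k by (auto simp: of_nat_diff)
      with 3 pq show ?thesis by auto
    qed
  qed
qed

text \<open>This handles walks whose range spans at least \<open>k\<close>, since the word of
  \<open>k\<close> c-edges is a candidate only for lists with two or more entries. Where one entry
  yields two words, their lengths add up to at most \<open>2 * k + 1\<close>, so one of them is at
  most \<open>k\<close>.\<close>

lemma same_column_candidates_le:
  assumes k: "2 \<le> k" and l: "\<forall>i\<in>set l. 0 < i \<and> i < k" and \<Delta>: "\<Delta> \<le> 1"
  shows "\<exists>cand\<in>set (result (same_column_candidates tie k \<Delta> l)). fst cand \<le> k"
proof (cases l rule: remdups_adj.cases)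
  case (2 i)
  with assms show ?thesis by auto
next
  case (3 i j l')
  then show ?thesis by (auto split: prod.splits)
qed (use k in auto)

section \<open>The complete list of candidates\<close>

definition candidates :: "(nat \<times> nat) tie_rule \<Rightarrow> nat \<Rightarrow> nat \<Rightarrow> nat list \<Rightarrow> candidate list" where
  "candidates tie k x Bs =
    (if x = 0
     then result (same_column_candidates tie k (of_bool (0 \<in> set Bs)) (filter (\<lambda>i. x < i) Bs))
     else [(k + x, [(C, k + x)]), (2 * k - x, [(A, 2 * k - x)])] @
       result (upper_candidates tie k x (of_bool (x \<in> set Bs)) (filter (\<lambda>i. x < i) Bs)) @
       result (lower_candidates tie k x (of_bool (0 \<in> set Bs)) (filter (\<lambda>j. 0 < j \<and> j < x) Bs)))"

lemma candidates_valid: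
  assumes k: "2 \<le> k" "x < k" and Bs: "sorted_wrt (<) Bs" "\<forall>i\<in>set Bs. i < k" "x = 0 \<Longrightarrow> Bs \<noteq> []"
    and cand: "cand \<in> set (candidates tie k x Bs)"
  shows "valid_candidate k x (set Bs) cand"
proof (cases "x = 0")
  case True
  then show ?thesis
    using same_column_candidates_valid[of k "set Bs" "filter (\<lambda>i. x < i) Bs" _ cand tie] assms
    by (auto simp: candidates_def sorted_wrt_filter)
next
  case False
  \<comment> \<open>The first two words go all the way round and end at \<open>x + k\<close> and
    \<open>x - 2 * k\<close>.\<close>
  then consider "cand = (k + x, [(C, k + x)])" | "cand = (2 * k - x, [(A, 2 * k - x)])"
    | "cand \<in> set (result (upper_candidates tie k x (of_bool (x \<in> set Bs)) (filter (\<lambda>i. x < i) Bs)))"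
    | "cand \<in> set (result (lower_candidates tie k x (of_bool (0 \<in> set Bs)) (filter (\<lambda>j. 0 < j \<and> j < x) Bs)))"
    using cand by (auto simp: candidates_def)
  then show ?thesis
  proof cases
    case 1
    with k Bs(2) show ?thesis by (auto simp: valid_candidate_def exponent_sum_def dest!: bspec)
  next
    case 2
    with k Bs(2) False show ?thesis
      by (auto simp: valid_candidate_def exponent_sum_def of_nat_diff min_def dest!: bspec)
  next
    case 3
    from upper_candidates_valid[OF _ k(2) Bs(2) _ _ refl this] False show ?thesis
      using Bs(1) by (auto simp: sorted_wrt_filter)
  next
    case 4
    from lower_candidates_valid[OF _ k(2) Bs(2) _ _ refl this] False show ?thesis
      using Bs(1) by (auto simp: sorted_wrt_filter)
  qed
qed

lemma candidates_optimal:
  fixes M m y \<alpha> \<beta> :: int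
  assumes k: "2 \<le> k" "x < k" and Bs: "sorted_wrt (<) Bs" "\<forall>i\<in>set Bs. i < k" "x = 0 \<Longrightarrow> Bs \<noteq> []"
    and span: "m \<le> 0" "0 \<le> M" "m \<le> y" "y \<le> M" "0 \<le> \<alpha>" "\<alpha> \<le> 1" "0 \<le> \<beta>" "\<beta> \<le> 1"
    and y: "y mod int k = int x"
    and cov: "\<forall>b\<in>set Bs. \<exists>z. m - \<alpha> \<le> z \<and> z < M + \<beta> \<and> z mod int k = int b"
  shows "\<exists>cand\<in>set (candidates tie k x Bs). int (fst cand) \<le> 2 * (M - m) - \<bar>y\<bar> + \<alpha> + \<beta>"
proof -
  define j where "j = y div int k"
  have yj: "y = int x + int k * j" using y unfolding j_def by (metis mod_mult_div_eq)
  have y_cases: "y = int x \<or> y = int x - int k \<or> int x + int k \<le> y \<or> y \<le> int x - 2 * int k"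
  proof -
    consider "j = 0" | "j = -1" | "1 \<le> j" | "j \<le> -2" by linarith
    then show ?thesis
    proof cases
      case 3
      then have "int k * 1 \<le> int k * j" by (intro mult_left_mono) auto
      with yj show ?thesis by simp
    next
      case 4
      then have "int k * j \<le> int k * (-2)" by (intro mult_left_mono) auto
      with yj show ?thesis by simp
    qed (use yj in auto)
  qed
  show ?thesis
  proof (cases "M - m < int k")
    case True
    \<comment> \<open>Since \<open>M - m < k\<close>, \<open>m \<le> 0 \<le> M\<close> and each end
      adds at most one position, \<open>- k \<le> z < k\<close>; so \<open>z\<close> is
      \<open>b\<close> or \<open>b - k\<close>.\<close>
    have cov': "\<forall>b\<in>set Bs. int b < M + \<beta> \<or> int k + m - \<alpha> \<le> int b"
    proof
      fix b assume "b \<in> set Bs"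
      with cov obtain z where z: "m - \<alpha> \<le> z" "z < M + \<beta>" "z mod int k = int b" by blast
      show "int b < M + \<beta> \<or> int k + m - \<alpha> \<le> int b"
      proof (cases "0 \<le> z")
        case True
        have "z < int k" using z(2) \<open>M - m < int k\<close> span by linarith
        with True z show ?thesis by (simp add: mod_pos_pos_trivial)
      next
        case False
        have "- int k \<le> z" using z(1) \<open>M - m < int k\<close> span by linarith
        then have "(z + int k) mod int k = z + int k" using False by (intro mod_pos_pos_trivial) auto
        then have "int b = z + int k" using z(3) by simp
        with z show ?thesis by linarith
      qed
    qed
    from y_cases True span k have "y = int x \<or> 0 < x \<and> y = int x - int k" by auto
    then consider "x = 0" "y = 0" | "0 < x" "y = int x" | "0 < x" "y = int x - int k"
      by (cases "x = 0") auto
    then show ?thesis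
    proof cases
      case 1
      then show ?thesis
        using same_column_candidates_optimal[OF k(1) Bs(2) _ _ _ refl span(1,2,5-8) True cov',
            of "filter (\<lambda>i. x < i) Bs" tie] Bs(1,3)
        by (auto simp: candidates_def sorted_wrt_filter)
    next
      case 2
      then have "int x \<le> M" using span by simp
      with 2 show ?thesis
        using upper_candidates_optimal[OF 2(1) k(2) Bs(2) _ _ refl span(1) _ span(5-8) cov',
            of "filter (\<lambda>i. x < i) Bs" tie] Bs(1)
        by (auto simp: candidates_def sorted_wrt_filter)
    next
      case 3
      then have "m \<le> int x - int k" using span by simp
      moreover have "\<bar>y\<bar> = int k - int x" using 3 k by simp
      ultimately show ?thesis
        using lower_candidates_optimal[OF 3(1) k(2) _ _ refl _ span(2,5-8) cov',
            of "filter (\<lambda>j. 0 < j \<and> j < x) Bs" tie] Bs(1) 3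
        by (auto simp: candidates_def sorted_wrt_filter)
    qed
  next
    case False
    show ?thesis
    proof (cases "x = 0")
      case True
      have "\<forall>i\<in>set (filter (\<lambda>i. x < i) Bs). 0 < i \<and> i < k" using Bs(2) by auto
      moreover have "of_bool (0 \<in> set Bs) \<le> (1 :: nat)" by (cases "0 \<in> set Bs") simp_all
      ultimately have "\<exists>cand\<in>set (result (same_column_candidates tie k (of_bool (0 \<in> set Bs))
        (filter (\<lambda>i. x < i) Bs))). fst cand \<le> k" by (intro same_column_candidates_le k(1))
      then obtain cand where "cand \<in> set (candidates tie k x Bs)" "fst cand \<le> k"
        using True by (auto simp: candidates_def)
      \<comment> \<open>Both \<open>0\<close> and \<open>y\<close> lie in the range, so
        \<open>\<bar>y\<bar> \<le> M - m\<close> and at least \<open>M - m \<ge> k\<close>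
        remains.\<close>
      moreover have "int k \<le> 2 * (M - m) - \<bar>y\<bar> + \<alpha> + \<beta>" using False span by (cases "0 \<le> y") auto
      ultimately show ?thesis by (metis of_nat_mono order_trans)
    next
      case x: False
      \<comment> \<open>With \<open>M - m \<ge> k\<close>, a walk ending at \<open>x\<close> costs
        at least \<open>2 * k - x\<close> and one ending at \<open>x - k\<close> at least
        \<open>k + x\<close>, as if it had gone round the other way; for all further ends
        \<open>\<bar>y\<bar>\<close> alone is large enough.\<close>
      from y_cases have "int (k + x) \<le> 2 * (M - m) - \<bar>y\<bar> + \<alpha> + \<beta> \<or>
        int (2 * k - x) \<le> 2 * (M - m) - \<bar>y\<bar> + \<alpha> + \<beta>"
        using False span k by (auto simp: of_nat_diff)
      with x show ?thesis by (auto simp: candidates_def)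
    qed
  qed
qed

section \<open>Walks in the digraph\<close>

lemma DPillar_simps [simp]:
  "verts (DPillar n k) = servers n k" "arcs (DPillar n k) = links n k"
  "tail (DPillar n k) e = fst e" "head (DPillar n k) e = snd (snd e)"
  by (simp_all add: DPillar_def)

lemma wf_DPillar:
  assumes "0 < k"
  shows "wf_digraph (DPillar n k)"
proof
  fix e assume "e \<in> arcs (DPillar n k)"
  moreover obtain a v m b v' where e: "e = ((a, v), m, (b, v'))" by (metis surj_pair)
  ultimately have "((a, v), m, (b, v')) \<in> links n k" by simp
  then have "(a, v) \<in> servers n k \<and> (b, v') \<in> servers n k"
    by (cases rule: links.cases) (use assms in \<open>auto simp: servers_def prev_col_def nth_list_update\<close>)
  then show "tail (DPillar n k) e \<in> verts (DPillar n k)" "head (DPillar n k) e \<in> verts (DPillar n k)"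
    by (simp_all add: e)
qed

text \<open>A repeated vertex would enclose a nonempty closed section, and cutting it out would give
  a shorter walk.\<close>

lemma (in wf_digraph) shortest_awalk_is_apath:
  assumes "awalk s p t" "\<And>q. awalk s q t \<Longrightarrow> length p \<le> length q"
  shows "shortest_path G s p t"
proof -
  have "distinct (awalk_verts s p)"
  proof (rule ccontr)
    assume "\<not> distinct (awalk_verts s p)"
    from awalk_not_distinct_decomp[OF assms(1) this] obtain q r q' v where
      "p = q @ r @ q'" "0 < length r" "awalk s q v" "awalk v q' t" by blast
    moreover from this have "length p \<le> length (q @ q')" by (intro assms(2) awalk_appendI)
    ultimately show False by simp
  qed
  with assms show ?thesis by (auto simp: shortest_path_def apath_def)
qed

locale routing =
  fixes n k c c' :: nat and u w :: "nat list"
  assumes k: "2 \<le> k" and src: "(c, u) \<in> servers n k" and row_dst: "(c', w) \<in> servers n k"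
begin

sublocale wf_digraph "DPillar n k"
  using wf_DPillar k by simp

text \<open>The column at \<open>z\<close> on the line; it is also the bit position between \<open>z\<close> and \<open>z + 1\<close>.\<close>

definition col :: "int \<Rightarrow> nat" where
  "col z = nat ((int c + z) mod int k)"

lemma int_col: "int (col z) = (int c + z) mod int k"
  unfolding col_def using k by simp

lemma col_less [simp]: "col z < k"
  using int_col[of z] k by (metis of_nat_0_less_iff of_nat_less_iff pos_mod_bound less_le_trans pos2)

lemma col_0: "col 0 = c"
  using src by (simp add: col_def servers_def)

lemma col_nat: "col (int b) = (c + b) mod k"
  unfolding col_def by (metis nat_int of_nat_add of_nat_mod)

lemma col_cong: "z mod int k = z' mod int k \<Longrightarrow> col z = col z'"
  unfolding col_def by (metis mod_add_right_eq)

lemma col_eqD: "col z = col z' \<Longrightarrow> z mod int k = z' mod int k"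
  by (metis int_col add_diff_cancel_left' mod_diff_left_eq)

lemma next_col_col: "(col z + 1) mod k = col (z + 1)"
proof -
  have "int ((col z + 1) mod k) = int (col (z + 1))"
    by (simp add: int_col zmod_int mod_simps algebra_simps)
  then show ?thesis by linarith
qed

lemma prev_col_col: "prev_col k (col z) = col (z - 1)"
proof -
  have "int (prev_col k (col z)) = (int (col z) + int k - 1) mod int k"
    using k by (simp add: prev_col_def zmod_int of_nat_diff)
  also have "\<dots> = ((int c + z) mod int k - 1) mod int k"
    unfolding int_col by (metis add_diff_eq diff_add_eq mod_add_self2)
  also have "\<dots> = (int c + (z - 1)) mod int k"
    by (simp add: mod_simps algebra_simps)
  finally show ?thesis unfolding int_col[symmetric] by linarith
qed

section \<open>Rows and covered intervals\<close>

text \<open>Each move writes the destination's bit, so the row depends only on which positions have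
  been covered, not on the order or multiplicity.\<close>

definition row :: "nat set \<Rightarrow> nat list" where
  "row S = map (\<lambda>i. if i \<in> S then w ! i else u ! i) [0..<k]"

lemma length_row [simp]: "length (row S) = k"
  by (simp add: row_def)

lemma nth_row [simp]: "i < k \<Longrightarrow> row S ! i = (if i \<in> S then w ! i else u ! i)"
  by (simp add: row_def)

lemma row_update: "(row S)[i := w ! i] = row (insert i S)"
proof (rule nth_equalityI)
  fix j assume "j < length ((row S)[i := w ! i])"
  then show "(row S)[i := w ! i] ! j = row (insert i S) ! j"
    by (cases "i = j") auto
qed simp

text \<open>The server reached when the walk stands at \<open>z\<close> and has covered \<open>[lo, hi)\<close>.\<close>

definition state :: "int \<Rightarrow> int \<Rightarrow> int \<Rightarrow> server" where
  "state lo z hi = (col z, row (col ` {lo..<hi}))"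

lemma state_server: "state lo z hi \<in> servers n k"
  using src row_dst by (auto simp: state_def servers_def)

lemma dst_less: "i < k \<Longrightarrow> w ! i < n div 2"
  using row_dst by (auto simp: servers_def)

text \<open>A c- or b-edge at \<open>z\<close> covers position \<open>z\<close>. That is in the
  interval already unless \<open>z\<close> is its upper end, so the covered set stays the image of
  an interval.\<close>

lemma extend_up:
  assumes "lo \<le> z" "z \<le> hi"
  shows "insert (col z) (col ` {lo..<hi}) = col ` {lo..<max hi (z + 1)}"
proof (cases "z = hi")
  case True
  then have "{lo..<max hi (z + 1)} = insert z {lo..<hi}" using assms by auto
  then show ?thesis by simp
next
  case False
  with assms show ?thesis by (auto simp: max_def)
qed

lemma extend_down:
  assumes "lo \<le> z" "z \<le> hi"
  shows "insert (col (z - 1)) (col ` {lo..<hi}) = col ` {min lo (z - 1)..<hi}"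
proof (cases "z = lo")
  case True
  then have "{min lo (z - 1)..<hi} = insert (z - 1) {lo..<hi}" using assms by auto
  then show ?thesis by simp
next
  case False
  with assms show ?thesis by (auto simp: min_def)
qed

section \<open>Single moves and powers as walks\<close>

abbreviation walks :: "server \<Rightarrow> move list \<Rightarrow> server \<Rightarrow> bool" where
  "walks s ms t \<equiv> awalk s (word_path k w s ms) t"

lemma walks_Cons:
  "(s, m, move_to k w m s) \<in> links n k \<Longrightarrow> walks (move_to k w m s) ms t \<Longrightarrow> walks s (m # ms) t"
  by (simp add: awalk_Cons_iff)

lemma walks_C:
  assumes "lo \<le> z" "z \<le> hi" "walks (state lo (z + 1) (max hi (z + 1))) ms t"
  shows "walks (state lo z hi) (C # ms) t"
proof -
  have *: "move_to k w C (state lo z hi) = state lo (z + 1) (max hi (z + 1))"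
    using next_col_col[of z] extend_up[OF assms(1,2)]
    by (simp add: move_to_def state_def row_update del: One_nat_def)
  show ?thesis
  proof (rule walks_Cons)
    show "(state lo z hi, C, move_to k w C (state lo z hi)) \<in> links n k"
      using c_edge[OF state_server[of lo z hi, unfolded state_def] dst_less[OF col_less[of z]]]
      by (simp add: move_to_def state_def)
  qed (use * assms(3) in simp)
qed

lemma walks_A:
  assumes "lo \<le> z" "z \<le> hi" "walks (state (min lo (z - 1)) (z - 1) hi) ms t"
  shows "walks (state lo z hi) (A # ms) t"
proof -
  have *: "move_to k w A (state lo z hi) = state (min lo (z - 1)) (z - 1) hi"
    using prev_col_col[of z] extend_down[OF assms(1,2)]
    by (simp add: move_to_def state_def row_update)
  show ?thesis
  proof (rule walks_Cons)
    show "(state lo z hi, A, move_to k w A (state lo z hi)) \<in> links n k"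
      using a_edge[OF state_server[of lo z hi, unfolded state_def] dst_less[OF col_less[of "z - 1"]]]
      by (simp add: move_to_def state_def prev_col_col)
  qed (use * assms(3) in simp)
qed

text \<open>Integers with the same column differ by a multiple of \<open>k\<close>, but
  \<open>z\<close> is less than \<open>k\<close> away from every point of the interval and outside
  it. So the position still carries the source's bit, which is why a d-edge there changes it; the
  mirrored fact serves b-edges.\<close>

lemma col_notin:
  assumes "z < lo" "hi \<le> z + int k"
  shows "col z \<notin> col ` {lo..<hi}"
proof
  assume "col z \<in> col ` {lo..<hi}"
  then obtain z' where z': "lo \<le> z'" "z' < hi" "col z = col z'" by auto
  then have "int k dvd z' - z" using col_eqD by (metis mod_eq_dvd_iff)
  then have "int k \<le> z' - z" using z' assms by (intro zdvd_imp_le) auto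
  with z' assms show False by linarith
qed

lemma col_notin':
  assumes "hi \<le> z" "z < lo + int k"
  shows "col z \<notin> col ` {lo..<hi}"
proof
  assume "col z \<in> col ` {lo..<hi}"
  then obtain z' where z': "lo \<le> z'" "z' < hi" "col z = col z'" by auto
  then have "int k dvd z - z'" using col_eqD by (metis mod_eq_dvd_iff)
  then have "int k \<le> z - z'" using z' assms by (intro zdvd_imp_le) auto
  with z' assms show False by linarith
qed

lemma walks_B:
  assumes "lo \<le> z" "hi - lo < int k" "z = hi" "u ! col z \<noteq> w ! col z" "walks (state lo z (hi + 1)) ms t"
  shows "walks (state lo z hi) (B # ms) t"
proof -
  have *: "move_to k w B (state lo z hi) = state lo z (hi + 1)"
    using extend_up[of lo z hi] assms(1,3)
    by (simp add: move_to_def state_def row_update)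
  have "w ! col z \<noteq> row (col ` {lo..<hi}) ! col z"
    using assms(4) col_notin'[of hi z lo] assms(2,3) by simp
  from b_edge[OF state_server[of lo z hi, unfolded state_def] dst_less[OF col_less[of z]] this]
  show ?thesis
    by (intro walks_Cons) (use * assms(5) in \<open>simp_all add: move_to_def state_def\<close>)
qed

lemma walks_D:
  assumes "z \<le> hi" "hi - lo < int k" "z = lo" "u ! col (z - 1) \<noteq> w ! col (z - 1)"
    "walks (state (lo - 1) z hi) ms t"
  shows "walks (state lo z hi) (D # ms) t"
proof -
  have *: "move_to k w D (state lo z hi) = state (lo - 1) z hi"
    using extend_down[of lo z hi] assms(1,3)
    by (simp add: move_to_def state_def row_update prev_col_col)
  have "w ! col (z - 1) \<noteq> row (col ` {lo..<hi}) ! col (z - 1)"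
    using assms(4) col_notin[of "z - 1" lo hi] assms(2,3) by simp
  then have "w ! col (z - 1) \<noteq> row (col ` {lo..<hi}) ! prev_col k (col z)"
    by (simp add: prev_col_col)
  from d_edge[OF state_server[of lo z hi, unfolded state_def] dst_less[OF col_less[of "z - 1"]] this]
  show ?thesis
    by (intro walks_Cons) (use * assms(5) in \<open>simp_all add: move_to_def state_def prev_col_col\<close>)
qed

lemma walks_replicate_C:
  "lo \<le> z \<Longrightarrow> z \<le> hi \<Longrightarrow> walks (state lo (z + int e) (max hi (z + int e))) ms t \<Longrightarrow>
    walks (state lo z hi) (replicate e C @ ms) t"
proof (induction e arbitrary: z hi)
  case (Suc e)
  have "max (max hi (z + 1)) (z + 1 + int e) = max hi (z + int (Suc e))" by simp
  then have "walks (state lo (z + 1) (max hi (z + 1))) (replicate e C @ ms) t"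
    using Suc.prems by (intro Suc.IH) (auto simp: algebra_simps)
  then show ?case using Suc.prems walks_C by simp
qed (simp add: max_absorb1)

lemma walks_replicate_A:
  "lo \<le> z \<Longrightarrow> z \<le> hi \<Longrightarrow> walks (state (min lo (z - int e)) (z - int e) hi) ms t \<Longrightarrow>
    walks (state lo z hi) (replicate e A @ ms) t"
proof (induction e arbitrary: z lo)
  case (Suc e)
  have "min (min lo (z - 1)) (z - 1 - int e) = min lo (z - int (Suc e))" by simp
  then have "walks (state (min lo (z - 1)) (z - 1) hi) (replicate e A @ ms) t"
    using Suc.prems by (intro Suc.IH) (auto simp: algebra_simps)
  then show ?case using Suc.prems walks_A by simp
qed (simp add: min_absorb1)

section \<open>From symbolic execution to walks\<close>

text \<open>The normalized set of differing positions: \<open>b\<close> is counted from the source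
  column.\<close>

definition differing :: "nat set" where
  "differing = {b. b < k \<and> u ! col (int b) \<noteq> w ! col (int b)}"

lemma differing_cover:
  assumes "i < k" "u ! i \<noteq> w ! i"
  obtains b where "b \<in> differing" "col (int b) = i"
proof
  let ?b = "nat ((int i - int c) mod int k)"
  have b: "int ?b = (int i - int c) mod int k" using k by simp
  then have "int (col (int ?b)) = int i" using assms(1) by (simp add: int_col mod_simps)
  then show "col (int ?b) = i" by linarith
  moreover have "?b < k" using k by (simp add: nat_less_iff)
  ultimately show "?b \<in> differing" using assms by (simp add: differing_def)
qed

text \<open>\<open>reaches\<close> executes the word symbolically; induction on the powers with the
  invariant \<open>lo \<le> z \<le> hi\<close> replays it in the digraph.\<close>

lemma reaches_walks:
  "reaches k x differing lo z hi p \<Longrightarrow> lo \<le> z \<Longrightarrow> z \<le> hi \<Longrightarrow>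
    walks (state lo z hi) (word p) (col (int x), w)"
proof (induction p arbitrary: lo z hi)
  case Nil
  \<comment> \<open>All four values that \<open>reaches\<close> allows at the end are congruent to
    \<open>x\<close>.\<close>
  have "z mod int k = int x mod int k"
    unfolding mod_eq_dvd_iff using Nil(1) by auto
  then have col: "col z = col (int x)" by (rule col_cong)
  have "row (col ` {lo..<hi}) = w"
  proof (rule nth_equalityI)
    show "length (row (col ` {lo..<hi})) = length w" using row_dst by (simp add: servers_def)
    fix i assume "i < length (row (col ` {lo..<hi}))"
    then have i: "i < k" by simp
    have "i \<in> col ` {lo..<hi}" if ui: "u ! i \<noteq> w ! i"
    proof -
      obtain b where b: "b \<in> differing" "col (int b) = i" using differing_cover[OF i ui] .
      with Nil(1) consider "int b \<in> {lo..<hi}" | "int b - int k \<in> {lo..<hi}" by auto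
      then show ?thesis
      proof cases
        case 1
        with b(2) show ?thesis by blast
      next
        case 2
        moreover have "col (int b - int k) = i" using b(2) col_cong[of "int b - int k" "int b"] by simp
        ultimately show ?thesis by blast
      qed
    qed
    with i show "row (col ` {lo..<hi}) ! i = w ! i" by auto
  qed
  with col show ?case
    using state_server[of lo z hi] by (simp add: word_def state_def awalk_Nil_iff)
next
  case (Cons q p)
  obtain m e where q: "q = (m, e)" by fastforce
  have word: "word (q # p) = replicate e m @ word p" by (simp add: word_def q)
  show ?case
  proof (cases m)
    case C
    with Cons(2) q have "reaches k x differing lo (z + int e) (max hi (z + int e)) p" by simp
    from Cons(1)[OF this] Cons(3,4) show ?thesis unfolding word C by (intro walks_replicate_C) auto
  next
    case A
    with Cons(2) q have "reaches k x differing (min lo (z - int e)) (z - int e) hi p" by simp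
    from Cons(1)[OF this] Cons(3,4) show ?thesis unfolding word A by (intro walks_replicate_A) auto
  next
    case B
    show ?thesis
    proof (cases "e = 0")
      case True
      with Cons q B word show ?thesis by simp
    next
      case False
      with Cons(2) q B have *: "e = 1" "z = hi" "hi - lo < int k" "0 \<le> z" "nat z \<in> differing"
        "reaches k x differing lo z (hi + 1) p" by auto
      have "u ! col z \<noteq> w ! col z" using *(4,5) by (simp add: differing_def)
      moreover have "walks (state lo z (hi + 1)) (word p) (col (int x), w)"
        using Cons(1)[OF *(6)] Cons(3,4) by simp
      ultimately show ?thesis using walks_B[of lo z hi "word p"] Cons(3) * word B by simp
    qed
  next
    case D
    show ?thesis
    proof (cases "e = 0")
      case True
      with Cons q D word show ?thesis by simp
    next
      case False
      with Cons(2) q D have *: "e = 1" "z = lo" "hi - lo < int k" "0 \<le> z - 1 + int k"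
        "nat (z - 1 + int k) \<in> differing" "reaches k x differing (lo - 1) z hi p" by auto
      \<comment> \<open>\<open>reaches\<close> names the position below \<open>z\<close> by its
        representative shifted up by \<open>k\<close>, to have a natural number.\<close>
      have "col (z - 1 + int k) = col (z - 1)" by (rule col_cong) simp
      then have "u ! col (z - 1) \<noteq> w ! col (z - 1)" using *(4,5) by (simp add: differing_def)
      moreover have "walks (state (lo - 1) z hi) (word p) (col (int x), w)"
        using Cons(1)[OF *(6)] Cons(3,4) by simp
      ultimately show ?thesis using walks_D[of z hi lo "word p"] Cons(4) * word D by simp
    qed
  qed
qed

text \<open>
  The lower bound: \<open>[m, M]\<close> is the range of the lifted walk, \<open>y\<close> its end, and \<open>\<alpha>\<close>, \<open>\<beta>\<close> tell
  whether the position beyond the respective end was covered by a d- or b-edge.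
\<close>

lemma walk_span:
  assumes "awalk (c, u) p t"
  shows "\<exists>m M y \<alpha> \<beta>. m \<le> 0 \<and> 0 \<le> M \<and> m \<le> y \<and> y \<le> M \<and> 0 \<le> \<alpha> \<and> \<alpha> \<le> 1 \<and> 0 \<le> \<beta> \<and> \<beta> \<le> 1 \<and>
    fst t = col y \<and> (\<forall>i<k. u ! i \<noteq> snd t ! i \<longrightarrow> i \<in> col ` {m - \<alpha>..<M + \<beta>}) \<and>
    2 * (M - m) - \<bar>y\<bar> + \<alpha> + \<beta> \<le> int (length p)"
  using assms
\<comment> \<open>Edges are added at the far end, so the line keeps its origin at the
  source.\<close>
proof (induction p arbitrary: t rule: rev_induct)
  case Nil
  then have "t = (c, u)" by (simp add: awalk_Nil_iff)
  then show ?case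
    by (intro exI[of _ 0]) (simp add: col_0)
next
  case (snoc e p)
  define s where "s = awlast (c, u) p"
  have p: "awalk (c, u) p s" and e: "(s, fst (snd e), t) \<in> links n k"
    using snoc(2) by (auto simp: s_def awalk_simps)
  from snoc(1)[OF p] obtain m M y \<alpha> \<beta> where span: "m \<le> 0" "0 \<le> M" "m \<le> y" "y \<le> M"
    "0 \<le> \<alpha>" "\<alpha> \<le> 1" "0 \<le> \<beta>" "\<beta> \<le> 1"
    and s: "fst s = col y" "\<forall>i<k. u ! i \<noteq> snd s ! i \<longrightarrow> i \<in> col ` {m - \<alpha>..<M + \<beta>}"
    and len: "2 * (M - m) - \<bar>y\<bar> + \<alpha> + \<beta> \<le> int (length p)" by blast
  \<comment> \<open>One more edge: the range may change as long as the covered interval only grows,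
    contains the new position \<open>i\<close>, and the cost rises by at most one.\<close>
  have goal: ?case if "m' \<le> 0 \<and> 0 \<le> M' \<and> m' \<le> y' \<and> y' \<le> M' \<and> 0 \<le> \<alpha>' \<and> \<alpha>' \<le> 1 \<and> 0 \<le> \<beta>' \<and> \<beta>' \<le> 1"
    "fst t = col y'" "snd t = (snd s)[col i := v]" "length (snd s) = k"
    "m' - \<alpha>' \<le> i" "i < M' + \<beta>'" "m' - \<alpha>' \<le> m - \<alpha>" "M + \<beta> \<le> M' + \<beta>'"
    "2 * (M' - m') - \<bar>y'\<bar> + \<alpha>' + \<beta>' \<le> 2 * (M - m) - \<bar>y\<bar> + \<alpha> + \<beta> + 1" for m' M' y' \<alpha>' \<beta>' i v
  proof -
    have "j \<in> col ` {m' - \<alpha>'..<M' + \<beta>'}" if "j < k" "u ! j \<noteq> snd t ! j" for j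
    proof (cases "j = col i")
      case True
      with \<open>m' - \<alpha>' \<le> i\<close> \<open>i < M' + \<beta>'\<close> show ?thesis by auto
    next
      case False
      with that \<open>snd t = _\<close> s(2) have "j \<in> col ` {m - \<alpha>..<M + \<beta>}" by simp
      moreover have "{m - \<alpha>..<M + \<beta>} \<subseteq> {m' - \<alpha>'..<M' + \<beta>'}"
        using \<open>m' - \<alpha>' \<le> m - \<alpha>\<close> \<open>M + \<beta> \<le> M' + \<beta>'\<close> by auto
      ultimately show ?thesis by blast
    qed
    moreover have "2 * (M' - m') - \<bar>y'\<bar> + \<alpha>' + \<beta>' \<le> int (length (p @ [e]))"
      using that(9) len by simp
    ultimately show ?thesis using that(1,2)
      by (intro exI[of _ m'] exI[of _ M'] exI[of _ y'] exI[of _ \<alpha>'] exI[of _ \<beta>']) simp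
  qed
  from e have "((fst s, snd s), fst (snd e), (fst t, snd t)) \<in> links n k" by simp
  then show ?case
  proof (cases rule: links.cases)
    case (c_edge y1)
    then have t: "fst t = col (y + 1)" "snd t = (snd s)[col y := y1]" "length (snd s) = k"
      using s(1) next_col_col[of y] by (auto simp: servers_def)
    show ?thesis
    proof (cases "y < M")
      case True
      \<comment> \<open>Within the range only \<open>\<bar>y\<bar>\<close> changes, by one.\<close>
      show ?thesis by (rule goal[OF _ t, of m M \<alpha> \<beta>]) (use True span in auto)
    next
      case False
      \<comment> \<open>Here \<open>y = M\<close>, so extending the range costs two, of which the
        growth of \<open>\<bar>y\<bar>\<close> returns one. The traversal now covers what
        \<open>\<beta>\<close> stood for, so \<open>\<beta>\<close> drops to
        \<open>0\<close>.\<close>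
      show ?thesis by (rule goal[OF _ t, of m "M + 1" \<alpha> 0]) (use False span in auto)
    qed
  next
    case (a_edge y1)
    then have t: "fst t = col (y - 1)" "snd t = (snd s)[col (y - 1) := y1]" "length (snd s) = k"
      using s(1) prev_col_col[of y] by (auto simp: servers_def)
    show ?thesis
    proof (cases "m < y")
      case True
      show ?thesis by (rule goal[OF _ t, of m M \<alpha> \<beta>]) (use True span in auto)
    next
      case False
      show ?thesis by (rule goal[OF _ t, of "m - 1" M 0 \<beta>]) (use False span in auto)
    qed
  next
    case (b_edge y1)
    then have t: "fst t = col y" "snd t = (snd s)[col y := y1]" "length (snd s) = k"
      using s(1) by (auto simp: servers_def)
    show ?thesis
    proof (cases "y < M")
      case True
      show ?thesis by (rule goal[OF _ t, of m M \<alpha> \<beta>]) (use True span in auto)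
    next
      case False
      \<comment> \<open>At the upper end the b-edge covers the position just beyond the range, which
        \<open>\<beta>\<close> pays for.\<close>
      show ?thesis by (rule goal[OF _ t, of m M \<alpha> 1]) (use False span in auto)
    qed
  next
    case (d_edge y1)
    then have t: "fst t = col y" "snd t = (snd s)[col (y - 1) := y1]" "length (snd s) = k"
      using s(1) prev_col_col[of y] by (auto simp: servers_def)
    show ?thesis
    proof (cases "m < y")
      case True
      show ?thesis by (rule goal[OF _ t, of m M \<alpha> \<beta>]) (use True span in auto)
    next
      case False
      show ?thesis by (rule goal[OF _ t, of m M 1 \<beta>]) (use False span in auto)
    qed
  qed
qed

end

section \<open>The algorithm\<close>

text \<open>The list is traversed at most twice, for the widest gap and for the last entry.\<close>

lemma steps_upper_candidates: "steps (upper_candidates tie k x \<Delta> l) \<le> 2 * length l + 1"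
  and length_upper_candidates: "length (result (upper_candidates tie k x \<Delta> l)) \<le> 3"
proof -
  have "steps (upper_candidates tie k x \<Delta> l) \<le> 2 * length l + 1 \<and>
    length (result (upper_candidates tie k x \<Delta> l)) \<le> 3"
  proof (cases l rule: remdups_adj.cases)
    case (3 i j l')
    with steps_widest_gap[of tie "(i, j)" "j # l'"] show ?thesis
      by (auto simp: last_of_timed split: prod.splits)
  qed auto
  then show "steps (upper_candidates tie k x \<Delta> l) \<le> 2 * length l + 1"
    and "length (result (upper_candidates tie k x \<Delta> l)) \<le> 3" by auto
qed

lemma steps_lower_candidates: "steps (lower_candidates tie k x \<Delta> l) \<le> 2 * length l + 1"
  and length_lower_candidates: "length (result (lower_candidates tie k x \<Delta> l)) \<le> 3"
proof -
  have "steps (lower_candidates tie k x \<Delta> l) \<le> 2 * length l + 1 \<and>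
    length (result (lower_candidates tie k x \<Delta> l)) \<le> 3"
  proof (cases l rule: remdups_adj.cases)
    case (3 i j l')
    with steps_widest_gap[of tie "(i, j)" "j # l'"] show ?thesis
      by (auto simp: last_of_timed split: prod.splits)
  qed auto
  then show "steps (lower_candidates tie k x \<Delta> l) \<le> 2 * length l + 1"
    and "length (result (lower_candidates tie k x \<Delta> l)) \<le> 3" by auto
qed

lemma steps_same_column_candidates: "steps (same_column_candidates tie k \<Delta> l) \<le> 2 * length l + 1"
  and length_same_column_candidates: "length (result (same_column_candidates tie k \<Delta> l)) \<le> 4"
proof -
  have "steps (same_column_candidates tie k \<Delta> l) \<le> 2 * length l + 1 \<and>
    length (result (same_column_candidates tie k \<Delta> l)) \<le> 4"
  proof (cases l rule: remdups_adj.cases)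
    case (3 i j l')
    with steps_widest_gap[of tie "(i, j)" "j # l'"] show ?thesis
      by (auto simp: last_of_timed split: prod.splits)
  qed auto
  then show "steps (same_column_candidates tie k \<Delta> l) \<le> 2 * length l + 1"
    and "length (result (same_column_candidates tie k \<Delta> l)) \<le> 4" by auto
qed

text \<open>Eight is two unconditional candidates plus three from each side; for
  \<open>x = 0\<close> there are at most four.\<close>

lemma length_candidates: "length (candidates tie k x Bs) \<le> 8"
  using length_upper_candidates[of tie k x "of_bool (x \<in> set Bs)" "filter (\<lambda>i. x < i) Bs"]
    length_lower_candidates[of tie k x "of_bool (0 \<in> set Bs)" "filter (\<lambda>j. 0 < j \<and> j < x) Bs"]
    length_same_column_candidates[of tie k "of_bool (0 \<in> set Bs)" "filter (\<lambda>i. x < i) Bs"]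
  unfolding candidates_def by (cases "x = 0") simp_all

context routing
begin

section \<open>Normalization of source and destination\<close>

text \<open>This is the normalized destination column \<open>x\<close>.\<close>

definition offset :: nat where
  "offset = (c' + k - c) mod k"

lemma offset_less: "offset < k"
  using k by (simp add: offset_def)

lemma int_offset: "int offset = (int c' - int c) mod int k"
proof -
  have "c < k" using src by (simp add: servers_def)
  then have "int offset = (int c' - int c + int k) mod int k"
    by (simp add: offset_def zmod_int of_nat_diff algebra_simps)
  then show ?thesis by simp
qed

lemma col_offset: "col (int offset) = c'"
proof -
  have "int (col (int offset)) = int c' mod int k"
    by (simp add: int_col int_offset mod_simps)
  then show ?thesis using row_dst by (simp add: servers_def)
qed

definition difference_list :: "nat list" where
  "difference_list = result (positions 0 (rotate c (map2 (\<noteq>) u w)))"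

text \<open>Rotation by \<open>c\<close> brings position \<open>c + b\<close> modulo
  \<open>k\<close> to index \<open>b\<close>.\<close>

lemma set_difference_list: "set difference_list = differing"
proof -
  have len: "length u = k" "length w = k" using src row_dst by (auto simp: servers_def)
  have "rotate c (map2 (\<noteq>) u w) ! b \<longleftrightarrow> u ! col (int b) \<noteq> w ! col (int b)" if "b < k" for b
  proof -
    have "rotate c (map2 (\<noteq>) u w) ! b = map2 (\<noteq>) u w ! col (int b)"
      using len that by (simp add: nth_rotate col_nat)
    also have "\<dots> = (u ! col (int b) \<noteq> w ! col (int b))"
      using len col_less[of "int b"] by simp
    finally show ?thesis by simp
  qed
  then show ?thesis using len
    by (auto simp: difference_list_def set_positions differing_def)
qed

lemma sorted_difference_list: "sorted_wrt (<) difference_list"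
  by (simp add: difference_list_def sorted_positions)

lemma difference_list_less: "\<forall>b\<in>set difference_list. b < k"
  by (simp add: set_difference_list differing_def)

text \<open>Distinct servers in the same column must differ in their rows. This justifies the single
  b-edge among the candidates for \<open>x = 0\<close>, which has to change a bit.\<close>

lemma difference_list_nonempty:
  assumes "(c, u) \<noteq> (c', w)" "offset = 0"
  shows "difference_list \<noteq> []"
proof
  assume "difference_list = []"
  then have "differing = {}" using set_difference_list by simp
  then have "u ! i = w ! i" if "i < k" for i
    using differing_cover[OF that] by blast
  then have "u = w" using src row_dst by (intro nth_equalityI) (auto simp: servers_def)
  moreover have "c = c'" using col_offset col_0 assms(2) by simp
  ultimately show False using assms(1) by simp
qed

text \<open>The lifted walk meets the hypotheses of \<open>candidates_optimal\<close>: its end lies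
  over column \<open>c'\<close>, and each differing position is the column of a point in its covered
  interval.\<close>

lemma candidates_shortest:
  assumes "(c, u) \<noteq> (c', w)" "awalk (c, u) q (c', w)"
  shows "\<exists>cand\<in>set (candidates tie k offset difference_list). fst cand \<le> length q"
proof -
  from walk_span[OF assms(2)] obtain m M y \<alpha> \<beta> where span: "m \<le> 0" "0 \<le> M" "m \<le> y" "y \<le> M"
    "0 \<le> \<alpha>" "\<alpha> \<le> 1" "0 \<le> \<beta>" "\<beta> \<le> 1" and y: "c' = col y"
    and cov: "\<forall>i<k. u ! i \<noteq> w ! i \<longrightarrow> i \<in> col ` {m - \<alpha>..<M + \<beta>}"
    and len: "2 * (M - m) - \<bar>y\<bar> + \<alpha> + \<beta> \<le> int (length q)"
    by auto
  have y_mod: "y mod int k = int offset"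
    using col_eqD[of y "int offset"] y col_offset offset_less by simp
  have diff_cov: "\<forall>b\<in>set difference_list. \<exists>z. m - \<alpha> \<le> z \<and> z < M + \<beta> \<and> z mod int k = int b"
  proof
    fix b assume "b \<in> set difference_list"
    then have b: "b < k" "u ! col (int b) \<noteq> w ! col (int b)"
      by (auto simp: set_difference_list differing_def)
    with cov have "col (int b) \<in> col ` {m - \<alpha>..<M + \<beta>}" by simp
    then obtain z where z: "m - \<alpha> \<le> z" "z < M + \<beta>" "col (int b) = col z" by auto
    then have "z mod int k = int b" using col_eqD[of "int b" z] b(1) by simp
    with z show "\<exists>z. m - \<alpha> \<le> z \<and> z < M + \<beta> \<and> z mod int k = int b" by blast
  qed
  have "\<exists>cand\<in>set (candidates tie k offset difference_list).
      int (fst cand) \<le> 2 * (M - m) - \<bar>y\<bar> + \<alpha> + \<beta>"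
    by (rule candidates_optimal[OF k offset_less sorted_difference_list difference_list_less
          difference_list_nonempty[OF assms(1)] span y_mod diff_cov])
  with len show ?thesis by (meson of_nat_le_iff order_trans)
qed

section \<open>The chosen candidate\<close>

definition choice :: "(nat \<times> nat) tie_rule \<Rightarrow> powers tie_rule \<Rightarrow> candidate" where
  "choice gap_tie path_tie = (let cands = candidates gap_tie k offset difference_list in
    result (best_candidate path_tie (hd cands) (tl cands)))"

lemma choice_props:
  assumes "(c, u) \<noteq> (c', w)"
  shows "choice gap_tie path_tie \<in> set (candidates gap_tie k offset difference_list)"
    "cand \<in> set (candidates gap_tie k offset difference_list) \<Longrightarrow>
      fst (choice gap_tie path_tie) \<le> fst cand"
proof -
  let ?cands = "candidates gap_tie k offset difference_list"
  \<comment> \<open>Only a nonempty list is recovered from \<open>hd\<close> and \<open>tl\<close>;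
    every shape of the position lists contributes some candidate.\<close>
  have "?cands \<noteq> []"
    by (cases "filter (\<lambda>i. offset < i) difference_list" rule: remdups_adj.cases)
      (auto simp: candidates_def split: prod.splits if_splits)
  then have *: "insert (hd ?cands) (set (tl ?cands)) = set ?cands"
    by (metis list.exhaust_sel list.simps(15))
  show "choice gap_tie path_tie \<in> set ?cands"
    using best_candidate_mem[of path_tie "hd ?cands" "tl ?cands"] * by (simp add: choice_def Let_def)
  show "cand \<in> set ?cands \<Longrightarrow> fst (choice gap_tie path_tie) \<le> fst cand"
    using best_candidate_min[of cand "hd ?cands" "tl ?cands" path_tie] * by (simp add: choice_def Let_def)
qed

lemma choice_valid:
  assumes "(c, u) \<noteq> (c', w)"
  shows "valid_candidate k offset differing (choice gap_tie path_tie)"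
  unfolding set_difference_list[symmetric]
  by (rule candidates_valid[OF k offset_less sorted_difference_list difference_list_less
        difference_list_nonempty[OF assms] choice_props(1)[OF assms]])

lemma choice_shortest:
  assumes "(c, u) \<noteq> (c', w)"
  shows "shortest_path (DPillar n k) (c, u)
    (word_path k w (c, u) (word (snd (choice gap_tie path_tie)))) (c', w)"
proof (rule shortest_awalk_is_apath)
  obtain L p where ch: "choice gap_tie path_tie = (L, p)" by fastforce
  from choice_valid[OF assms, of gap_tie path_tie] ch
  have L: "exponent_sum p = L" and p: "reaches k offset differing 0 0 0 p" by (auto simp: valid_candidate_def)
  \<comment> \<open>With the empty interval no bit has been overwritten yet.\<close>
  have "state 0 0 0 = (c, u)"
    using src by (auto simp: state_def col_0 servers_def row_def intro: nth_equalityI)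
  with reaches_walks[OF p] ch
  show "walks (c, u) (word (snd (choice gap_tie path_tie))) (c', w)" by (simp add: col_offset)
  have length_word_path: "length (word_path k w s ms) = length ms" for s ms
    by (induction ms arbitrary: s) auto
  fix q assume "awalk (c, u) q (c', w)"
  from candidates_shortest[OF assms this, of gap_tie] obtain cand where
    "cand \<in> set (candidates gap_tie k offset difference_list)" "fst cand \<le> length q" by blast
  with choice_props(2)[OF assms this(1), of path_tie] ch L
  show "length (word_path k w (c, u) (word (snd (choice gap_tie path_tie)))) \<le> length q"
    by (simp add: length_word_path length_word)
qed

section \<open>Result and running time of the algorithm\<close>

lemma result_DPillarMin:
  "result (DPillarMin gap_tie path_tie k (c, u) (c', w)) = word (snd (choice gap_tie path_tie))"
proof -
  have len: "length u = k" "length w = k" "c < k" using src row_dst by (auto simp: servers_def)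
  then have rot: "drop c (map2 (\<noteq>) u w) @ take c (map2 (\<noteq>) u w) = rotate c (map2 (\<noteq>) u w)"
    by (simp add: rotate_drop_take)
  show ?thesis
    using len unfolding DPillarMin_def
    by (simp add: differences_timed split_list_timed append_list_timed rot select_timed
        result_occurs spell_out_timed case_prod_beta Let_def choice_def candidates_def
        flip: difference_list_def offset_def)
qed

lemma steps_DPillarMin:
  assumes "(c, u) \<noteq> (c', w)"
  shows "steps (DPillarMin gap_tie path_tie k (c, u) (c', w)) \<le> 40 * k"
proof -
  have len: "length u = k" "length w = k" "c < k" using src row_dst by (auto simp: servers_def)
  then have rot: "drop c (map2 (\<noteq>) u w) @ take c (map2 (\<noteq>) u w) = rotate c (map2 (\<noteq>) u w)"
    by (simp add: rotate_drop_take)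
  have Bs: "length difference_list \<le> k"
    using length_positions[of 0 "rotate c (map2 (\<noteq>) u w)"] len by (simp add: difference_list_def)
  let ?upper = "filter (\<lambda>i. offset < i) difference_list"
  let ?lower = "filter (\<lambda>j. 0 < j \<and> j < offset) difference_list"
  have filters: "length ?upper \<le> k" "length ?lower \<le> k"
    using Bs length_filter_le order_trans by blast+
  have occurs: "steps (occurs i difference_list) \<le> k + 1" for i
    using steps_occurs[of i difference_list] Bs by linarith
  have spell: "exponent_sum (snd (choice gap_tie path_tie)) + 2 * length (snd (choice gap_tie path_tie)) \<le> 4 * k + 10"
    using choice_valid[OF assms, of gap_tie path_tie] by (auto simp: valid_candidate_def case_prod_beta)
  define cand_steps where "cand_steps = (if offset = 0
    then steps (same_column_candidates gap_tie k (of_bool (0 \<in> set difference_list)) ?upper)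
    else steps (upper_candidates gap_tie k offset (of_bool (offset \<in> set difference_list)) ?upper) +
      steps (lower_candidates gap_tie k offset (of_bool (0 \<in> set difference_list)) ?lower))"
  have cands: "cand_steps \<le> 4 * k + 2"
    using steps_upper_candidates[of gap_tie k offset "of_bool (offset \<in> set difference_list)" ?upper]
      steps_lower_candidates[of gap_tie k offset "of_bool (0 \<in> set difference_list)" ?lower]
      steps_same_column_candidates[of gap_tie k "of_bool (0 \<in> set difference_list)" ?upper] filters
    unfolding cand_steps_def by (cases "offset = 0") simp_all
  have best: "length (tl (candidates gap_tie k offset difference_list)) \<le> 8"
    using length_candidates[of gap_tie k offset difference_list] by simp
  \<comment> \<open>The summand \<open>k + 2\<close> joins \<open>c + 1\<close> steps for the split
    and \<open>k - c + 1\<close> for the append.\<close>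
  have "steps (DPillarMin gap_tie path_tie k (c, u) (c', w)) =
    1 + (k + 1) + (k + 2) + (k + 1) +
    steps (occurs 0 difference_list) + steps (occurs offset difference_list) +
    2 * (length difference_list + 1) + cand_steps +
    (length (tl (candidates gap_tie k offset difference_list)) + 1) +
    (exponent_sum (snd (choice gap_tie path_tie)) + 2 * length (snd (choice gap_tie path_tie)) + 1)"
    using len unfolding DPillarMin_def
    by (simp add: differences_timed split_list_timed append_list_timed rot select_timed steps_positions
        steps_best_candidate result_occurs spell_out_timed case_prod_beta Let_def choice_def candidates_def
        cand_steps_def flip: difference_list_def offset_def)
  \<comment> \<open>The bounds add up to \<open>15 * k + 31\<close>, which is at most
    \<open>40 * k\<close> for \<open>k \<ge> 2\<close>.\<close>
  with occurs[of 0] occurs[of offset] Bs cands best spell k show ?thesis by simp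
qed

end

theorem theorem4:
  "(\<forall>n k src dst gap_tie path_tie.
      n \<ge> 2 \<and> even n \<and> k \<ge> 2 \<and> src \<in> servers n k \<and> dst \<in> servers n k \<and> src \<noteq> dst \<longrightarrow>
      shortest_path (DPillar n k) src
        (word_path k (snd dst) src (result (DPillarMin gap_tie path_tie k src dst))) dst) \<and>
   (\<exists>K. \<forall>n k src dst gap_tie path_tie.
      n \<ge> 2 \<and> even n \<and> k \<ge> 2 \<and> src \<in> servers n k \<and> dst \<in> servers n k \<and> src \<noteq> dst \<longrightarrow>
      steps (DPillarMin gap_tie path_tie k src dst) \<le> K * k)"
proof -
  have correct: "shortest_path (DPillar n k) src
        (word_path k (snd dst) src (result (DPillarMin gap_tie path_tie k src dst))) dst"
    and fast: "steps (DPillarMin gap_tie path_tie k src dst) \<le> 40 * k"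
    if "k \<ge> 2" "src \<in> servers n k" "dst \<in> servers n k" "src \<noteq> dst" for n k src dst gap_tie path_tie
  proof -
    obtain c u c' w where ends: "src = (c, u)" "dst = (c', w)" by fastforce
    interpret routing n k c c' u w
      using that ends by unfold_locales auto
    show "shortest_path (DPillar n k) src
        (word_path k (snd dst) src (result (DPillarMin gap_tie path_tie k src dst))) dst"
      using choice_shortest that(4) ends by (simp add: result_DPillarMin)
    show "steps (DPillarMin gap_tie path_tie k src dst) \<le> 40 * k"
      using steps_DPillarMin that(4) ends by simp
  qed
  show ?thesis
    by (intro conjI exI[of _ 40] allI impI) (blast intro: correct fast)+
qed

end
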